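(* Let $k \ge 2$ be an even integer, let $\alpha \ge -\frac{2k+1}{4}$ be real, and let $x$ belong to one of the following intervals depending on the value of $\alpha$: (i) $0 \le x \le \sqrt{1-\frac1u}$, if $|\alpha| < \sqrt{7/6}$; (ii) $0 \le x \le \sqrt{1-q}$, if $\alpha \in \left[-\frac{2k+1}{4}, -\sqrt{7/6}\,\right] \cup \left[\sqrt{7/6}, \infty\right)$. Then $$g(x) = g(0)\big(\cos \mathcal{B}(x) + r(x)\big),$$ where $$g(0) = \left(-\frac14\right)^{k/2} \binom{k+\alpha}{k/2} \left(k^2+2k\alpha+k+\alpha+1\right)^{1/4},$$ where, for $q \ge 0$, $$\mathcal{B}(x) = \sqrt{u}\left(\arccos\sqrt{\frac{1-q-x^2}{1-q}} - \sqrt{q}\,\arccos\sqrt{\frac{1-q-x^2}{(1-q)(1-x^2)}}\right),$$ and, for $q < 0$, $$\mathcal{B}(x) = \sqrt{u}\left(\arccos\sqrt{\frac{1-q-x^2}{1-q}} + \sqrt{-q}\,\operatorname{arccosh}\sqrt{\frac{1-q-x^2}{(1-q)(1-x^2)}}\right),$$ and where the error term $r(x)$ satisfies $$|r(x)| \le \begin{cases} \dfrac{2.72\, x}{\sqrt{(1-x^2)u}}, & q<0,\\[2ex] \dfrac{2(1-x^2)x}{(1-q)(1-q-x^2)^{3/2}\sqrt{u}}, & 0 \le q < \frac12,\\[2ex] \dfrac{(1+q)x}{4(1-q-x^2)^{3/2}\sqrt{u}}, & \frac12 \le q < 1,\end{cases}$$ with strict inequality for $x>0$ (at the endpoint $x=\sqrt{1-q}$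 in case (ii) the right-hand side is read as $+\infty$).
   Context: $P_k^{(\alpha,\alpha)}$ is the ultraspherical polynomial, i.e. the Jacobi polynomial $P_k^{(\alpha,\beta)}$ with $\beta=\alpha$ in the standard normalization, $P_k^{(\alpha,\beta)}(x) = 2^{-k}\sum_{j=0}^k \binom{k+\alpha}{j}\binom{k+\beta}{k-j}(x-1)^{k-j}(x+1)^j$, where $\binom{a}{j} = a(a-1)\cdots(a-j+1)/j!$ for real $a$ and integer $j\ge 0$ (this makes sense for all real $\alpha$). Put $$u=(k+\alpha)(k+\alpha+1),\qquad q=\frac{\alpha^2-1}{u}.$$ (For $k\ge2$, $\alpha\ge -(2k+1)/4$ one has $u>0$ and $q<1$; $q<0$ corresponds to $|\alpha|<1$.) Define $$b(x)=\frac{\sqrt{(1-q-x^2)u}}{1-x^2},\qquad g(x)=\sqrt{b(x)}\,(1-x^2)^{(\alpha+1)/2}P_k^{(\alpha,\alpha)}(x).$$ The function $r$ is defined by the displayed identity $g(x) = g(0)(\cos\mathcal{B}(x)+r(x))$. *)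

theory Defs
  imports "HOL-Analysis.Analysis"
begin

definition jacobi_P :: "nat \<Rightarrow> real \<Rightarrow> real \<Rightarrow> real \<Rightarrow> real" where
  "jacobi_P k \<alpha> \<beta> x =
     (1 / 2 ^ k) * (\<Sum>j = 0..k. ((real k + \<alpha>) gchoose j) * ((real k + \<beta>) gchoose (k - j))
                                 * (x - 1) ^ (k - j) * (x + 1) ^ j)"

definition param_u :: "nat \<Rightarrow> real \<Rightarrow> real" where
  "param_u k \<alpha> = (real k + \<alpha>) * (real k + \<alpha> + 1)"

definition param_q :: "nat \<Rightarrow> real \<Rightarrow> real" where
  "param_q k \<alpha> = (\<alpha>\<^sup>2 - 1) / param_u k \<alpha>"

definition func_b :: "nat \<Rightarrow> real \<Rightarrow> real \<Rightarrow> real" where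
  "func_b k \<alpha> x = sqrt ((1 - param_q k \<alpha> - x\<^sup>2) * param_u k \<alpha>) / (1 - x\<^sup>2)"

definition func_g :: "nat \<Rightarrow> real \<Rightarrow> real \<Rightarrow> real" where
  "func_g k \<alpha> x =
     sqrt (func_b k \<alpha> x) * (1 - x\<^sup>2) powr ((\<alpha> + 1) / 2) * jacobi_P k \<alpha> \<alpha> x"

definition phase_B :: "nat \<Rightarrow> real \<Rightarrow> real \<Rightarrow> real" where
  "phase_B k \<alpha> x =
     (let u = param_u k \<alpha>; q = param_q k \<alpha> in
      if q \<ge> 0 then
        sqrt u * (arccos (sqrt ((1 - q - x\<^sup>2) / (1 - q)))
                  - sqrt q * arccos (sqrt ((1 - q - x\<^sup>2) / ((1 - q) * (1 - x\<^sup>2)))))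
      else
        sqrt u * (arccos (sqrt ((1 - q - x\<^sup>2) / (1 - q)))
                  + sqrt (- q) * arcosh (sqrt ((1 - q - x\<^sup>2) / ((1 - q) * (1 - x\<^sup>2))))))"

(* The identity g(x) = g(0) (cos B(x) + r(x)) solved for r(x). Division by zero yields 0,
   so the identity itself is not automatic: it needs g(0) \<noteq> 0. *)
definition err_r :: "nat \<Rightarrow> real \<Rightarrow> real \<Rightarrow> real" where
  "err_r k \<alpha> x = func_g k \<alpha> x / func_g k \<alpha> 0 - cos (phase_B k \<alpha> x)"

(* Extended-real valued because the bound blows up at the turning point x = sqrt (1 - q),
   where real division would give 0 instead. For q < 0 the points x considered stay
   below sqrt (1 - 1 / u) < 1. The last case is only used for q < 1. *)
definition err_bound :: "nat \<Rightarrow> real \<Rightarrow> real \<Rightarrow> ereal" where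
  "err_bound k \<alpha> x =
     (let u = param_u k \<alpha>; q = param_q k \<alpha> in
      if q < 0 then ereal (2.72 * x / sqrt ((1 - x\<^sup>2) * u))
      else if x = sqrt (1 - q) then \<infinity>
      else if q < 1 / 2 then
        ereal (2 * (1 - x\<^sup>2) * x / ((1 - q) * (1 - q - x\<^sup>2) powr (3 / 2) * sqrt u))
      else
        ereal ((1 + q) * x / (4 * (1 - q - x\<^sup>2) powr (3 / 2) * sqrt u)))"

end

theory Submission
  imports Defs
begin

text \<open>
  Write \<open>c = 1 - q\<close>. The function \<open>(1 - x\<^sup>2) powr ((\<alpha> + 1) / 2) * P\<close>, where \<open>P\<close> is the ultraspherical
  polynomial, solves \<open>z'' + b\<^sup>2 z = 0\<close>, and \<open>b\<close> is the derivative of the phase \<open>B\<close>. Hence, with the phase as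
  the independent variable, \<open>g = sqrt b * z\<close> obeys the equation \<open>g'' + p g = 0\<close> of an oscillator whose
  squared frequency is \<open>p = 1 + N (x\<^sup>2) / (4 u (c - x\<^sup>2) ^ 3)\<close> with an explicit cubic polynomial \<open>N\<close>
  (\<open>defect_num\<close>, \<open>freq\<close>, \<open>deriv_g\<close>, \<open>deriv_G\<close>). As \<open>k\<close> is even, \<open>g\<close> starts at its value \<open>g 0\<close> with slope 0, so the
  unperturbed motion is \<open>g 0 * cos B\<close>.

  Variation of constants bounds the deviation by the integral of \<open>b \<bar>p - 1\<bar> \<bar>g\<bar>\<close> over \<open>[0, x]\<close>. No integral
  is evaluated: the claimed bound is a function \<open>R\<close> with \<open>R 0 = 0\<close>, and it suffices that
  \<open>b \<bar>p - 1\<bar> M < R'\<close> for a constant \<open>M\<close> with \<open>\<bar>g\<bar> \<le> M \<bar>g 0\<bar>\<close> (\<open>perturbed_oscillator_error\<close>, \<open>error_less\<close>).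
  This also makes the bound strict.

  The constant \<open>M\<close> comes from Sonin's energies \<open>p g\<^sup>2 + G\<^sup>2\<close> and \<open>g\<^sup>2 + G\<^sup>2 / p\<close>, where \<open>G\<close> is the derivative of
  \<open>g\<close> with respect to the phase: the first one decreases where \<open>p\<close> does, the second one where \<open>p\<close> increases.
  The derivative of \<open>p\<close> factors so well that \<open>p\<close> is seen to decrease first and to increase afterwards, one of
  the two parts being possibly absent. Therefore \<open>\<bar>g\<bar>\<close> is controlled by \<open>p 0\<close> and a lower bound of \<open>p\<close>
  (\<open>oscillator_amplitude\<close>, \<open>amplitude\<close>). Three ranges of \<open>c\<close> arise.

  \<^item> If \<open>q \<ge> 1/2\<close>, then \<open>p\<close> increases from a value of at least 1 and \<open>M = 1\<close>.
  \<^item> If \<open>0 \<le> q < 1/2\<close>, then \<open>p \<ge> 1/4\<close> or \<open>p\<close> is increasing, and \<open>M = 2\<close>. Here the threshold \<open>7/6\<close> enters.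
    For \<open>\<alpha>\<^sup>2 \<ge> 7/6\<close> the lower bound holds up to the turning point \<open>sqrt c\<close>; for smaller \<open>\<alpha>\<^sup>2\<close> the minimum
    of \<open>p\<close> may be negative, and \<open>x\<close> has to be kept away from 1 by \<open>1 - x\<^sup>2 \<ge> 1/u\<close>.
  \<^item> If \<open>q < 0\<close>, then \<open>p\<close> is decreasing, \<open>1 - x\<^sup>2 \<ge> 1/u\<close> gives \<open>p \<ge> 1/6\<close>, and \<open>M = sqrt 6\<close>.

  What remains are polynomial inequalities in \<open>c\<close> and \<open>x\<^sup>2\<close>.
\<close>

section \<open>The differential equation of the ultraspherical polynomials\<close>

definition monomial_deriv :: "nat \<Rightarrow> nat \<Rightarrow> real \<Rightarrow> real" where
  "monomial_deriv m n x = real m * (x - 1) ^ (m - 1) * (x + 1) ^ n + real n * (x - 1) ^ m * (x + 1) ^ (n - 1)"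

definition monomial_deriv2 :: "nat \<Rightarrow> nat \<Rightarrow> real \<Rightarrow> real" where
  "monomial_deriv2 m n x = real m * monomial_deriv (m - 1) n x + real n * monomial_deriv m (n - 1) x"

lemma has_derivative_monomial: "((\<lambda>x. (x - 1) ^ m * (x + 1) ^ n) has_real_derivative monomial_deriv m n x) (at x)"
  unfolding monomial_deriv_def by (auto intro!: derivative_eq_intros)

lemma has_derivative_monomial_deriv: "((\<lambda>x. monomial_deriv m n x) has_real_derivative monomial_deriv2 m n x) (at x)"
  using DERIV_add[OF DERIV_cmult[OF has_derivative_monomial[of "m - 1" n x]] DERIV_cmult[OF has_derivative_monomial[of m "n - 1" x]], of "real m" "real n"]
  unfolding monomial_deriv_def[of m n] monomial_deriv2_def mult.assoc .

text \<open>
  In terms of \<open>X = x - 1\<close> and \<open>Y = x + 1\<close> one has \<open>1 - x\<^sup>2 = - X Y\<close> and \<open>2 x = X + Y\<close>, so the ultraspherical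
  operator is homogeneous of degree 0 and sends a monomial in \<open>X\<close>, \<open>Y\<close> to a combination of itself and its
  two neighbours of the same degree. This makes the differential equation a statement about three
  consecutive coefficients.
\<close>

lemma ultraspherical_operator_monomial:
  "(x - 1) * (x + 1) * monomial_deriv2 m n x + 2 * (\<alpha> + 1) * x * monomial_deriv m n x
   = real m * (real m + \<alpha>) * ((x - 1) ^ (m - 1) * (x + 1) ^ (n + 1))
   + real n * (real n + \<alpha>) * ((x - 1) ^ (m + 1) * (x + 1) ^ (n - 1))
   + (2 * real m * real n + (\<alpha> + 1) * (real m + real n)) * ((x - 1) ^ m * (x + 1) ^ n)"
proof -
  have lower: "real i * z ^ (i - 1) * z = real i * z ^ i"
    "real i * (real (i - 1) * z ^ (i - 1 - 1)) * z = (real i - 1) * (real i * z ^ (i - 1))" for i and z :: real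
    by (cases i; cases "i - 1"; simp)+
  define X Y where XY: "X = x - 1" "Y = x + 1"
  define A0 A1 A2 where A: "A0 = X ^ m" "A1 = real m * X ^ (m - 1)" "A2 = real m * (real (m - 1) * X ^ (m - 1 - 1))"
  define B0 B1 B2 where B: "B0 = Y ^ n" "B1 = real n * Y ^ (n - 1)" "B2 = real n * (real (n - 1) * Y ^ (n - 1 - 1))"
  have A': "A1 * X = m * A0" "A2 * X = (real m - 1) * A1" and B': "B1 * Y = n * B0" "B2 * Y = (real n - 1) * B1"
    unfolding A B by (rule lower)+
  have "X * Y * (A2 * B0 + 2 * A1 * B1 + A0 * B2) + (\<alpha> + 1) * (X + Y) * (A1 * B0 + A0 * B1)
    = (A2 * X) * Y * B0 + 2 * (A1 * X) * (B1 * Y) + X * A0 * (B2 * Y)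
      + (\<alpha> + 1) * ((A1 * X) * B0 + X * A0 * B1 + Y * A1 * B0 + A0 * (B1 * Y))"
    by (simp add: algebra_simps)
  also have "\<dots> = (real m + \<alpha>) * A1 * (Y * B0) + (real n + \<alpha>) * (X * A0) * B1
      + (2 * real m * real n + (\<alpha> + 1) * (real m + real n)) * (A0 * B0)"
    unfolding A' B' by (simp add: algebra_simps)
  finally have main: "X * Y * (A2 * B0 + 2 * A1 * B1 + A0 * B2) + (\<alpha> + 1) * (X + Y) * (A1 * B0 + A0 * B1) = \<dots>" .
  have m1: "monomial_deriv m n x = A1 * B0 + A0 * B1"
    by (simp add: monomial_deriv_def A B XY)
  have m2: "monomial_deriv2 m n x = A2 * B0 + 2 * A1 * B1 + A0 * B2"
    by (simp add: monomial_deriv2_def monomial_deriv_def A B XY algebra_simps)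
  have x: "2 * (\<alpha> + 1) * x = (\<alpha> + 1) * (X + Y)" by (simp add: XY)
  show ?thesis
    unfolding m1 m2 x XY[symmetric] main by (simp add: A B algebra_simps)
qed

lemma gchoose_step: "real (Suc n) * (a gchoose Suc n) = (a - real n) * ((a::real) gchoose n)"
  using gbinomial_absorption[of n a] gbinomial_absorb_comp[of a n] by simp

definition ultra_coeff :: "nat \<Rightarrow> real \<Rightarrow> nat \<Rightarrow> real" where
  "ultra_coeff k \<alpha> j = ((real k + \<alpha>) gchoose j) * ((real k + \<alpha>) gchoose (k - j))"

text \<open>
  This relation turns the contribution that a monomial receives from either neighbour into a multiple of its
  own coefficient.
\<close>

lemma ultra_coeff_step:
  assumes "j < k"
  shows "ultra_coeff k \<alpha> (Suc j) * (real (Suc j) * (real (Suc j) + \<alpha>))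
       = ultra_coeff k \<alpha> j * (real (k - j) * (real (k - j) + \<alpha>))"
proof -
  obtain i where k: "k = Suc (j + i)" using assms less_iff_Suc_add by blast
  define a where "a = real k + \<alpha>"
  have e: "real (Suc j) + \<alpha> = a - real i" "real (Suc i) + \<alpha> = a - real j" by (simp_all add: a_def k)
  have kj: "k - j = Suc i" "k - Suc j = i" using k by simp_all
  show ?thesis unfolding ultra_coeff_def kj e a_def[symmetric]
    using gchoose_step[of j a] gchoose_step[of i a] by algebra
qed

definition ultra_sum where "ultra_sum k \<alpha> x = 1 / 2 ^ k * (\<Sum>j=0..k. ultra_coeff k \<alpha> j * ((x - 1) ^ (k - j) * (x + 1) ^ j))"
definition ultra_deriv where "ultra_deriv k \<alpha> x = 1 / 2 ^ k * (\<Sum>j=0..k. ultra_coeff k \<alpha> j * monomial_deriv (k - j) j x)"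
definition ultra_deriv2 where "ultra_deriv2 k \<alpha> x = 1 / 2 ^ k * (\<Sum>j=0..k. ultra_coeff k \<alpha> j * monomial_deriv2 (k - j) j x)"

lemma jacobi_P_ultra: "jacobi_P k \<alpha> \<alpha> x = ultra_sum k \<alpha> x"
  by (simp add: jacobi_P_def ultra_sum_def ultra_coeff_def mult_ac)

lemma has_derivative_jacobi_P: "(jacobi_P k \<alpha> \<alpha> has_real_derivative ultra_deriv k \<alpha> x) (at x)"
  unfolding ultra_deriv_def jacobi_P_ultra[THEN ext] ultra_sum_def[abs_def]
  by (intro DERIV_cmult DERIV_sum has_derivative_monomial)

lemma has_derivative_ultra_deriv: "(ultra_deriv k \<alpha> has_real_derivative ultra_deriv2 k \<alpha> x) (at x)"
  unfolding ultra_deriv_def[abs_def] ultra_deriv2_def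
  by (intro DERIV_cmult DERIV_sum has_derivative_monomial_deriv)

text \<open>
  After shifting the summation index, both neighbour terms become multiples of the coefficient itself, and
  the three factors add up to \<open>k * (k + 2 * \<alpha> + 1)\<close>.
\<close>

lemma ultra_ode:
  "(1 - x\<^sup>2) * ultra_deriv2 k \<alpha> x - 2 * (\<alpha> + 1) * x * ultra_deriv k \<alpha> x
     + real k * (real k + 2 * \<alpha> + 1) * jacobi_P k \<alpha> \<alpha> x = 0"
proof -
  define T where "T i j = (x - 1) ^ i * (x + 1) ^ j" for i j
  define w where "w j = real j * (real j + \<alpha>)" for j
  define c where "c = ultra_coeff k \<alpha>"
  have lin: "(\<Sum>j=0..k. c j * (A * f j + B * h j)) = A * (\<Sum>j=0..k. c j * f j) + B * (\<Sum>j=0..k. c j * h j)"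
    for A B f h by (simp add: sum_distrib_left sum.distrib distrib_left mult.left_commute)
  have sc: "(\<Sum>j=0..k. A * (c j * f j)) = A * (\<Sum>j=0..k. c j * f j)" for A f
    by (simp add: sum_distrib_left)
  have op: "(x - 1) * (x + 1) * monomial_deriv2 (k - j) j x + 2 * (\<alpha> + 1) * x * monomial_deriv (k - j) j x
      = w (k - j) * T (k - j - 1) (j + 1) + w j * T (k - j + 1) (j - 1)
        + (2 * real (k - j) * real j + (\<alpha> + 1) * (real (k - j) + real j)) * T (k - j) j" for j
    unfolding T_def w_def by (rule ultraspherical_operator_monomial)
  have step: "c (Suc j) * w (Suc j) = c j * w (k - j)" if "j < k" for j
    unfolding c_def w_def using that by (rule ultra_coeff_step)
  have up: "(\<Sum>j=0..k. c j * (w (k - j) * T (k - j - 1) (j + 1))) = (\<Sum>j=0..k. c j * (w j * T (k - j) j))"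
  proof -
    have "(\<Sum>j=0..k. c j * (w (k - j) * T (k - j - 1) (j + 1))) = (\<Sum>j<k. c j * (w (k - j) * T (k - j - 1) (j + 1)))"
      by (intro sum.mono_neutral_right) (auto simp: w_def)
    also have "\<dots> = (\<Sum>j<k. c (Suc j) * (w (Suc j) * T (k - Suc j) (Suc j)))"
      using step by (intro sum.cong) (auto simp flip: mult.assoc)
    also have "\<dots> = (\<Sum>j\<in>{1..k}. c j * (w j * T (k - j) j))"
      by (rule sum.reindex_bij_witness[of _ "\<lambda>j. j - 1" Suc]) auto
    also have "\<dots> = (\<Sum>j=0..k. c j * (w j * T (k - j) j))"
      by (intro sum.mono_neutral_left) (auto simp: w_def Suc_le_eq)
    finally show ?thesis .
  qed
  have down: "(\<Sum>j=0..k. c j * (w j * T (k - j + 1) (j - 1))) = (\<Sum>j=0..k. c j * (w (k - j) * T (k - j) j))"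
  proof -
    have "(\<Sum>j=0..k. c j * (w j * T (k - j + 1) (j - 1))) = (\<Sum>j\<in>{1..k}. c j * (w j * T (k - j + 1) (j - 1)))"
      by (intro sum.mono_neutral_right) (auto simp: w_def Suc_le_eq)
    also have "\<dots> = (\<Sum>j<k. c (Suc j) * (w (Suc j) * T (k - j) j))"
      by (rule sum.reindex_bij_witness[of _ Suc "\<lambda>j. j - 1"]) (auto simp: Suc_diff_le)
    also have "\<dots> = (\<Sum>j<k. c j * (w (k - j) * T (k - j) j))"
      using step by (intro sum.cong) (auto simp flip: mult.assoc)
    also have "\<dots> = (\<Sum>j=0..k. c j * (w (k - j) * T (k - j) j))"
      by (intro sum.mono_neutral_left) (auto simp: w_def)
    finally show ?thesis .
  qed
  have "(\<Sum>j=0..k. c j * ((x - 1) * (x + 1) * monomial_deriv2 (k - j) j x + 2 * (\<alpha> + 1) * x * monomial_deriv (k - j) j x))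
      = (\<Sum>j=0..k. c j * (w j * T (k - j) j)) + (\<Sum>j=0..k. c j * (w (k - j) * T (k - j) j))
       + (\<Sum>j=0..k. c j * ((2 * real (k - j) * real j + (\<alpha> + 1) * (real (k - j) + real j)) * T (k - j) j))"
    unfolding op up[symmetric] down[symmetric] by (simp only: distrib_left sum.distrib)
  also have "\<dots> = (\<Sum>j=0..k. real k * (real k + 2 * \<alpha> + 1) * (c j * T (k - j) j))"
    unfolding sum.distrib[symmetric]
    by (intro sum.cong) (auto simp: w_def of_nat_diff algebra_simps)
  finally have "(x - 1) * (x + 1) * (\<Sum>j=0..k. c j * monomial_deriv2 (k - j) j x) + 2 * (\<alpha> + 1) * x * (\<Sum>j=0..k. c j * monomial_deriv (k - j) j x)
     = real k * (real k + 2 * \<alpha> + 1) * (\<Sum>j=0..k. c j * T (k - j) j)"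
    unfolding lin sc .
  hence "(x - 1) * (x + 1) * (2 ^ k * ultra_deriv2 k \<alpha> x) + 2 * (\<alpha> + 1) * x * (2 ^ k * ultra_deriv k \<alpha> x)
     = real k * (real k + 2 * \<alpha> + 1) * (2 ^ k * ultra_sum k \<alpha> x)"
    by (simp add: ultra_sum_def ultra_deriv_def ultra_deriv2_def c_def T_def)
  hence "2 ^ k * ((1 - x\<^sup>2) * ultra_deriv2 k \<alpha> x - 2 * (\<alpha> + 1) * x * ultra_deriv k \<alpha> x
     + real k * (real k + 2 * \<alpha> + 1) * ultra_sum k \<alpha> x) = 0"
    by (simp add: algebra_simps power2_eq_square)
  thus ?thesis by (simp add: jacobi_P_ultra)
qed

lemma jacobi_P_even:
  assumes "even k"
  shows "jacobi_P k \<alpha> \<alpha> (- x) = jacobi_P k \<alpha> \<alpha> x"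
proof -
  have "(\<Sum>j=0..k. ultra_coeff k \<alpha> j * ((- x - 1) ^ (k - j) * (- x + 1) ^ j))
      = (\<Sum>j=0..k. ultra_coeff k \<alpha> j * ((x - 1) ^ (k - j) * (x + 1) ^ j))"
  proof (rule sum.reindex_bij_witness[of _ "\<lambda>j. k - j" "\<lambda>j. k - j"])
    fix j assume j: "j \<in> {0..k}"
    have "(- x - 1) ^ (k - j) * (- x + 1) ^ j = (- (x + 1)) ^ (k - j) * (- (x - 1)) ^ j"
      by simp
    also have "\<dots> = (- 1) ^ (k - j) * (- 1) ^ j * ((x - 1) ^ j * (x + 1) ^ (k - j))"
      unfolding power_minus[of "x + 1"] power_minus[of "x - 1"] by (simp only: mult_ac)
    also have "(- 1 :: real) ^ (k - j) * (- 1) ^ j = 1"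
      using j assms by (simp flip: power_add)
    finally show "ultra_coeff k \<alpha> (k - j) * ((x - 1) ^ (k - (k - j)) * (x + 1) ^ (k - j))
      = ultra_coeff k \<alpha> j * ((- x - 1) ^ (k - j) * (- x + 1) ^ j)"
      using j by (simp add: ultra_coeff_def)
  qed auto
  thus ?thesis by (simp add: jacobi_P_ultra ultra_sum_def)
qed

lemma ultra_deriv_0:
  assumes "even k"
  shows "ultra_deriv k \<alpha> 0 = 0"
proof -
  have "((\<lambda>x. jacobi_P k \<alpha> \<alpha> (- x)) has_real_derivative ultra_deriv k \<alpha> (- 0) * (- 1)) (at 0)"
    by (rule DERIV_chain2[OF has_derivative_jacobi_P]) (auto intro!: derivative_eq_intros)
  hence "(jacobi_P k \<alpha> \<alpha> has_real_derivative - ultra_deriv k \<alpha> 0) (at 0)"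
    using jacobi_P_even[OF assms] by simp
  from DERIV_unique[OF this has_derivative_jacobi_P] show ?thesis by simp
qed

text \<open>
  The sum is the coefficient of \<open>z ^ (2 * m)\<close> in \<open>(1 + z) powr a * (1 - z) powr a = (1 - z\<^sup>2) powr a\<close>. The product
  \<open>H\<close> of the two binomial series satisfies \<open>(1 - z\<^sup>2) H' = - 2 a z H\<close>, a two-step recurrence for its
  coefficients that determines the even ones.
\<close>

lemma alternating_gbinomial_convolution:
  "(\<Sum>j=0..2*m. (a gchoose j) * (a gchoose (2*m - j)) * (- 1) ^ (2*m - j)) = (- 1) ^ m * ((a::real) gchoose m)"
proof -
  define F where "F = fps_binomial a"
  define F' where "F' = Abs_fps (\<lambda>n. (-1) ^ n * (a gchoose n))"
  define H where "H = F * F'"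
  have Hn: "fps_nth H n = (\<Sum>j=0..n. (a gchoose j) * ((-1) ^ (n-j) * (a gchoose (n-j))))" for n
    by (simp add: H_def F_def F'_def fps_mult_nth)
  note gr = gchoose_step[of _ a]
  have 1: "(1 + fps_X) * fps_deriv F = fps_const a * F"
  proof (rule fps_ext)
    fix n show "fps_nth ((1 + fps_X) * fps_deriv F) n = fps_nth (fps_const a * F) n"
      using gr[of n] by (cases n) (auto simp: F_def algebra_simps)
  qed
  have 2: "(1 - fps_X) * fps_deriv F' = - fps_const a * F'"
  proof (rule fps_ext)
    fix n show "fps_nth ((1 - fps_X) * fps_deriv F') n = fps_nth (- fps_const a * F') n"
      using arg_cong[OF gr[of n], of "\<lambda>y. (- 1) ^ n * y"]
      by (cases n) (auto simp: F'_def algebra_simps)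
  qed
  have 3: "(1 - fps_X^2) * fps_deriv H = - (fps_const a + fps_const a) * fps_X * H"
  proof -
    have "(1 - fps_X^2) * fps_deriv H = (1 - fps_X) * F' * ((1 + fps_X) * fps_deriv F) + (1 + fps_X) * F * ((1 - fps_X) * fps_deriv F')"
      by (simp add: H_def power2_eq_square algebra_simps)
    also have "\<dots> = - (fps_const a + fps_const a) * fps_X * H" unfolding 1 2 H_def by algebra
    finally show ?thesis .
  qed
  have rec: "real (n+2) * fps_nth H (n+2) = (real n - 2*a) * fps_nth H n" for n
    using arg_cong[OF 3, of "\<lambda>f. fps_nth f (n+1)"]
    by (cases n) (simp_all add: algebra_simps power2_eq_square)
  have "fps_nth H (2*m) = (- 1) ^ m * (a gchoose m)"
  proof (induction m)
    case 0 show ?case by (simp add: Hn)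
  next
    case (Suc m)
    have "real (2*m+2) * fps_nth H (2*m+2) = (real (2*m) - 2*a) * ((- 1) ^ m * (a gchoose m))"
      using rec[of "2*m"] Suc by simp
    also have "\<dots> = - 2 * (-1)^m * ((a - real m) * (a gchoose m))" by (simp add: algebra_simps)
    also have "\<dots> = real (2*m+2) * ((-1)^Suc m * (a gchoose Suc m))"
      unfolding gr[symmetric] by (simp add: algebra_simps)
    finally have "fps_nth H (2*m+2) = (-1)^Suc m * (a gchoose Suc m)"
      by (subst (asm) mult_left_cancel) auto
    thus ?case by simp
  qed
  thus ?thesis by (simp add: Hn mult_ac)
qed

lemma jacobi_P_0:
  assumes "even k"
  shows "jacobi_P k \<alpha> \<alpha> 0 = (- 1 / 4) ^ (k div 2) * ((real k + \<alpha>) gchoose (k div 2))"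
proof -
  obtain m where k: "k = 2 * m" using assms by blast
  have "(- 1 :: real) ^ m / 2 ^ (2 * m) = (- 1 / 4) ^ m"
    unfolding power_mult power_divide[symmetric] by simp
  thus ?thesis
    using alternating_gbinomial_convolution[of "real k + \<alpha>" m] by (simp add: jacobi_P_def k field_simps)
qed

section \<open>Amplitude and error of a perturbed oscillator\<close>

text \<open>
  Variation of constants. Here \<open>G\<close> is the derivative of \<open>g\<close> with respect to the phase \<open>\<theta>\<close>. The quantity
  \<open>\<phi> s\<close> of the proof is the value that the unperturbed oscillator, released at \<open>s\<close> in the state \<open>(g s, G s)\<close>,
  reaches at \<open>x\<close>. It would be constant for \<open>p = 1\<close>, so its derivative carries the factor \<open>p - 1\<close>, and it moves
  from \<open>g 0 * cos (\<theta> x)\<close> to \<open>g x\<close>.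
\<close>

lemma perturbed_oscillator_error:
  fixes g G \<theta> b p R R' :: "real \<Rightarrow> real"
  assumes "0 < x"
    and g: "\<And>s. s \<in> {0..x} \<Longrightarrow> (g has_real_derivative b s * G s) (at s)"
    and G: "\<And>s. s \<in> {0..x} \<Longrightarrow> (G has_real_derivative - b s * p s * g s) (at s)"
    and \<theta>: "\<And>s. s \<in> {0..x} \<Longrightarrow> (\<theta> has_real_derivative b s) (at s)"
    and R: "\<And>s. s \<in> {0..x} \<Longrightarrow> (R has_real_derivative R' s) (at s)"
    and bound: "\<And>s. s \<in> {0..x} \<Longrightarrow> \<bar>b s * (p s - 1) * g s\<bar> < R' s"
    and "G 0 = 0" "\<theta> 0 = 0"
  shows "\<bar>g x - g 0 * cos (\<theta> x)\<bar> < R x - R 0"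
proof -
  define \<phi> where "\<phi> s = g s * cos (\<theta> x - \<theta> s) + G s * sin (\<theta> x - \<theta> s)" for s
  have \<phi>: "(\<phi> has_real_derivative - (b s * (p s - 1) * g s * sin (\<theta> x - \<theta> s))) (at s)"
    if "s \<in> {0..x}" for s
    unfolding \<phi>_def
    by (rule derivative_eq_intros g[OF that] G[OF that] \<theta>[OF that] refl)+ (simp add: algebra_simps)
  have small: "\<bar>b s * (p s - 1) * g s * sin (\<theta> x - \<theta> s)\<bar> < R' s" if "s \<in> {0..x}" for s
  proof -
    have "\<bar>b s * (p s - 1) * g s * sin (\<theta> x - \<theta> s)\<bar> \<le> \<bar>b s * (p s - 1) * g s\<bar> * 1"
      unfolding abs_mult[of _ "sin _"] by (intro mult_left_mono) auto
    thus ?thesis using bound[OF that] by simp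
  qed
  have "R 0 + \<phi> 0 < R x + \<phi> x"
  proof (rule DERIV_pos_imp_increasing[OF \<open>0 < x\<close>])
    fix s assume "0 \<le> s" "s \<le> x"
    hence s: "s \<in> {0..x}" by simp
    show "\<exists>y. ((\<lambda>s. R s + \<phi> s) has_real_derivative y) (at s) \<and> 0 < y"
      using DERIV_add[OF R[OF s] \<phi>[OF s]] small[OF s] by force
  qed
  moreover have "R 0 - \<phi> 0 < R x - \<phi> x"
  proof (rule DERIV_pos_imp_increasing[OF \<open>0 < x\<close>])
    fix s assume "0 \<le> s" "s \<le> x"
    hence s: "s \<in> {0..x}" by simp
    show "\<exists>y. ((\<lambda>s. R s - \<phi> s) has_real_derivative y) (at s) \<and> 0 < y"
      using DERIV_diff[OF R[OF s] \<phi>[OF s]] small[OF s] by force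
  qed
  moreover have "\<phi> x = g x" "\<phi> 0 = g 0 * cos (\<theta> x)"
    using assms by (auto simp: \<phi>_def)
  ultimately show ?thesis by linarith
qed

text \<open>
  Sonin's argument. The energy \<open>p g\<^sup>2 + G\<^sup>2\<close> has derivative \<open>p' g\<^sup>2\<close>, and \<open>g\<^sup>2 + G\<^sup>2 / p\<close> has derivative
  \<open>- p' (G / p)\<^sup>2\<close>. The first one is used up to the point \<open>\<xi>\<close> where \<open>p\<close> stops decreasing, the second one from there
  on; the two agree at \<open>\<xi>\<close> up to the factor \<open>p \<xi>\<close>.
\<close>

lemma oscillator_amplitude:
  fixes g G b p p' :: "real \<Rightarrow> real"
  assumes g: "\<And>s. s \<in> {0..x} \<Longrightarrow> (g has_real_derivative b s * G s) (at s)"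
    and G: "\<And>s. s \<in> {0..x} \<Longrightarrow> (G has_real_derivative - b s * p s * g s) (at s)"
    and p: "\<And>s. s \<in> {0..x} \<Longrightarrow> (p has_real_derivative p' s) (at s)"
    and lower: "\<And>s. s \<in> {0..x} \<Longrightarrow> m \<le> p s" and m: "0 < m"
    and dec: "\<And>s. s \<in> {0..x} \<Longrightarrow> s \<le> \<xi> \<Longrightarrow> p' s \<le> 0"
    and inc: "\<And>s. s \<in> {0..x} \<Longrightarrow> \<xi> \<le> s \<Longrightarrow> 0 \<le> p' s"
    and \<xi>: "0 \<le> \<xi>" and x: "0 \<le> x" and G0: "G 0 = 0"
  shows "(g x)\<^sup>2 \<le> p 0 / m * (g 0)\<^sup>2"
proof -
  have dec_part: "p t * (g t)\<^sup>2 + (G t)\<^sup>2 \<le> p 0 * (g 0)\<^sup>2" if t: "0 \<le> t" "t \<le> x" "t \<le> \<xi>" for t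
  proof -
    have "p t * (g t)\<^sup>2 + (G t)\<^sup>2 \<le> p 0 * (g 0)\<^sup>2 + (G 0)\<^sup>2"
    proof (rule DERIV_nonpos_imp_nonincreasing[OF t(1)])
      fix s assume "0 \<le> s" "s \<le> t"
      hence s: "s \<in> {0..x}" "s \<le> \<xi>" using t by auto
      have "((\<lambda>s. p s * (g s)\<^sup>2 + (G s)\<^sup>2) has_real_derivative p' s * (g s)\<^sup>2) (at s)"
        by (rule derivative_eq_intros p[OF s(1)] g[OF s(1)] G[OF s(1)] refl)+
           (simp add: algebra_simps power2_eq_square)
      thus "\<exists>y. ((\<lambda>s. p s * (g s)\<^sup>2 + (G s)\<^sup>2) has_real_derivative y) (at s) \<and> y \<le> 0"
        using dec[OF s] by (meson mult_nonpos_nonneg zero_le_power2)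
    qed
    thus ?thesis by (simp add: G0)
  qed
  define t where "t = min x \<xi>"
  have t: "0 \<le> t" "t \<le> x" "t \<le> \<xi>" using \<xi> x by (auto simp: t_def)
  have pos: "0 < p s" if "s \<in> {0..x}" for s using lower[OF that] m by linarith
  have "(g x)\<^sup>2 + (G x)\<^sup>2 / p x \<le> (g t)\<^sup>2 + (G t)\<^sup>2 / p t"
  proof (cases "x \<le> \<xi>")
    case True thus ?thesis by (simp add: t_def)
  next
    case False
    hence "t = \<xi>" by (simp add: t_def)
    show ?thesis
    proof (rule DERIV_nonpos_imp_nonincreasing[OF t(2)])
      fix s assume "t \<le> s" "s \<le> x"
      hence s: "s \<in> {0..x}" using t by auto
      have ps: "p s \<noteq> 0" using pos[OF s] by simp
      have "((\<lambda>s. (g s)\<^sup>2 + (G s)\<^sup>2 / p s) has_real_derivative - (p' s * (G s / p s)\<^sup>2)) (at s)"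
        by (rule derivative_eq_intros p[OF s(1)] g[OF s(1)] G[OF s(1)] refl ps)+
           (use ps in \<open>simp add: field_simps power2_eq_square\<close>)
      moreover have "- (p' s * (G s / p s)\<^sup>2) \<le> 0"
        using inc[OF s] \<open>t \<le> s\<close> \<open>t = \<xi>\<close> by simp
      ultimately show "\<exists>y. ((\<lambda>s. (g s)\<^sup>2 + (G s)\<^sup>2 / p s) has_real_derivative y) (at s) \<and> y \<le> 0"
        by blast
    qed
  qed
  hence "(g x)\<^sup>2 \<le> (g t)\<^sup>2 + (G t)\<^sup>2 / p t"
    using pos[of x] x by (smt (verit) atLeastAtMost_iff divide_nonneg_pos zero_le_power2)
  also have "\<dots> = (p t * (g t)\<^sup>2 + (G t)\<^sup>2) / p t"
    using pos[of t] t by (simp add: field_simps)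
  also have "\<dots> \<le> p 0 * (g 0)\<^sup>2 / p t"
    using dec_part[OF t] pos[of t] t by (intro divide_right_mono) auto
  also have "\<dots> \<le> p 0 * (g 0)\<^sup>2 / m"
    using lower[of t] t m pos[of 0] x by (intro divide_left_mono) auto
  finally show ?thesis by simp
qed

section \<open>The Liouville-Green form of the equation\<close>

text \<open>
  With \<open>f = 1 / sqrt b\<close>, the Liouville-Green substitution turns \<open>z'' + b\<^sup>2 z = 0\<close> into an oscillator with squared
  frequency \<open>1 + f'' f\<^sup>3\<close>. The polynomial below is the numerator of \<open>f'' f\<^sup>3\<close> as a function of \<open>y = x\<^sup>2\<close>.
\<close>

definition defect_num :: "real \<Rightarrow> real \<Rightarrow> real" where
  "defect_num c y = 2 * c * (1 - 2 * c) + 3 * y - 6 * (1 - c) * y\<^sup>2 - y ^ 3"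

definition freq :: "real \<Rightarrow> real \<Rightarrow> real \<Rightarrow> real" where
  "freq u c x = 1 + defect_num c (x\<^sup>2) / (4 * u * (c - x\<^sup>2) ^ 3)"

text \<open>
  The combination of the numerator and its derivative that appears in the derivative of the frequency is
  only quadratic in \<open>x\<^sup>2\<close> and has the root 1. Hence on positive \<open>x\<close> inside \<open>x\<^sup>2 < 1\<close> the sign changes only at
  \<open>x\<^sup>2 = c (4 c - 3) / (2 - c)\<close>.
\<close>

lemma deriv_freq:
  assumes "x\<^sup>2 < c" "0 < u"
  shows "(freq u c has_real_derivative
     6 * x * (1 - x\<^sup>2) * ((2 - c) * x\<^sup>2 - c * (4 * c - 3)) / (4 * u * (c - x\<^sup>2) ^ 4)) (at x)"
proof -
  define N' where "N' = 2 * x * (3 - 12 * (1 - c) * x\<^sup>2 - 3 * (x\<^sup>2)\<^sup>2)"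
  define w where "w = c - x\<^sup>2"
  have w: "w > 0" using assms by (simp add: w_def)
  have N: "((\<lambda>x. defect_num c (x\<^sup>2)) has_real_derivative N') (at x)"
    unfolding defect_num_def N'_def
    by (auto intro!: derivative_eq_intros simp: algebra_simps power2_eq_square power3_eq_cube)
  have D: "((\<lambda>x. 4 * u * (c - x\<^sup>2) ^ 3) has_real_derivative 4 * u * (3 * w ^ 2 * (- 2 * x))) (at x)"
    by (auto intro!: derivative_eq_intros simp: w_def)
  have "(freq u c has_real_derivative
     (N' * (4 * u * w ^ 3) - defect_num c (x\<^sup>2) * (4 * u * (3 * w ^ 2 * (- 2 * x)))) / ((4 * u * w ^ 3) * (4 * u * w ^ 3))) (at x)"
    unfolding freq_def
    using DERIV_add[OF DERIV_const[of 1] DERIV_divide[OF N D]] w assms by (simp add: w_def)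
  also have "(N' * (4 * u * w ^ 3) - defect_num c (x\<^sup>2) * (4 * u * (3 * w ^ 2 * (- 2 * x)))) / ((4 * u * w ^ 3) * (4 * u * w ^ 3))
      = (N' * w + 6 * x * defect_num c (x\<^sup>2)) / (4 * u * w ^ 4)"
    using w assms by (simp add: divide_simps) (simp add: algebra_simps power_numeral_reduce)
  also have "N' * w + 6 * x * defect_num c (x\<^sup>2) = 6 * x * (1 - x\<^sup>2) * ((2 - c) * x\<^sup>2 - c * (4 * c - 3))"
    unfolding N'_def w_def defect_num_def
    by (simp add: algebra_simps power_numeral_reduce)
  finally show ?thesis by (simp add: w_def)
qed

text \<open>
  The parameter \<open>c = 1 - q\<close> is the square of the turning point, where \<open>b\<close> vanishes. The ranges \<open>q < 0\<close> and
  \<open>q < 1/2\<close> are \<open>c > 1\<close> and \<open>c > 1/2\<close>.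
\<close>

locale ultraspherical =
  fixes k :: nat and \<alpha> u c :: real
  assumes k: "k \<ge> 2" "even k" and \<alpha>: "\<alpha> \<ge> - (2 * real k + 1) / 4"
    and u: "u = param_u k \<alpha>" and c: "c = 1 - param_q k \<alpha>"
begin

lemma u_ge: "u \<ge> 21 / 16"
proof -
  have "real k \<ge> 2" using k by simp
  hence "real k + \<alpha> \<ge> 3 / 4" using \<alpha> by simp
  hence "(real k + \<alpha>) * (real k + \<alpha> + 1) \<ge> 3 / 4 * (3 / 4 + 1)"
    by (intro mult_mono) auto
  thus ?thesis by (simp add: u param_u_def)
qed

lemma u_pos: "u > 0" using u_ge by simp

lemma u_q: "u * (1 - c) = \<alpha>\<^sup>2 - 1"
  using u_pos by (simp add: c param_q_def u)

lemma u_c: "u * c = (real k)\<^sup>2 + 2 * real k * \<alpha> + real k + \<alpha> + 1"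
  using u_q by (simp add: u param_u_def algebra_simps power2_eq_square)

lemma c_pos: "c > 0"
proof -
  have "(2 * real k + 1) * (\<alpha> + (2 * real k + 1) / 4) \<ge> 0"
    using \<alpha> by (intro mult_nonneg_nonneg) (auto simp: field_simps)
  moreover have "(2 * real k + 1) * (\<alpha> + (2 * real k + 1) / 4) = u * c - 3 / 4"
    unfolding u_c by (simp add: field_simps power2_eq_square)
  ultimately have "u * c > 0" by linarith
  thus ?thesis using u_pos by (simp add: zero_less_mult_iff)
qed

text \<open>
  The functions \<open>\<mu>\<close> and \<open>\<sigma>\<close> are the negative logarithmic derivatives of \<open>sqrt b\<close> and \<open>\<omega>\<close>, so that \<open>G\<close> is the
  derivative of \<open>g = sqrt b * \<omega> * P\<close> divided by \<open>b\<close>, which is its derivative with respect to the phase.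
\<close>

definition "b = func_b k \<alpha>"
definition "\<omega> x = (1 - x\<^sup>2) powr ((\<alpha> + 1) / 2)"
definition "\<mu> x = x / (2 * (c - x\<^sup>2)) - x / (1 - x\<^sup>2)"
definition "\<sigma> x = (\<alpha> + 1) * x / (1 - x\<^sup>2)"
definition "G x = \<omega> x / sqrt (b x) * (ultra_deriv k \<alpha> x - (\<mu> x + \<sigma> x) * jacobi_P k \<alpha> \<alpha> x)"

lemma b_eq: "b x = sqrt ((c - x\<^sup>2) * u) / (1 - x\<^sup>2)"
  by (simp add: b_def func_b_def c u)

lemma g_eq: "func_g k \<alpha> x = sqrt (b x) * \<omega> x * jacobi_P k \<alpha> \<alpha> x"
  by (simp add: func_g_def b_def \<omega>_def)

context
  fixes x :: real
  assumes x1: "x\<^sup>2 < 1" and xc: "x\<^sup>2 < c"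
begin

lemma b_pos: "b x > 0"
  using x1 xc u_pos by (simp add: b_eq)

lemma b_sq: "(b x)\<^sup>2 = u * (c - x\<^sup>2) / (1 - x\<^sup>2)\<^sup>2"
  using xc u_pos by (simp add: b_eq power_divide)

lemma deriv_\<omega>: "(\<omega> has_real_derivative - \<sigma> x * \<omega> x) (at x)"
proof -
  have *: "(1 - x\<^sup>2) powr ((\<alpha> + 1) / 2) = (1 - x\<^sup>2) powr ((\<alpha> + 1) / 2 - 1) * (1 - x\<^sup>2)"
    using x1 powr_add[of "1 - x\<^sup>2" "(\<alpha> + 1) / 2 - 1" 1] unfolding diff_add_cancel by simp
  show ?thesis unfolding \<omega>_def[abs_def] \<sigma>_def *
    using x1 by (auto intro!: derivative_eq_intros)
qed

lemma deriv_sqrt_b: "((\<lambda>x. sqrt (b x)) has_real_derivative - \<mu> x * sqrt (b x)) (at x)"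
proof -
  define w h where "w = c - x\<^sup>2" and "h = 1 - x\<^sup>2"
  have w: "w > 0" "h > 0" using x1 xc by (simp_all add: w_def h_def)
  have s: "((\<lambda>x. sqrt ((c - x\<^sup>2) * u)) has_real_derivative - (x / w) * sqrt (w * u)) (at x)"
  proof -
    have "((\<lambda>x. sqrt ((c - x\<^sup>2) * u)) has_real_derivative (- 2 * x * u) * (inverse (sqrt (w * u)) / 2)) (at x)"
      using w u_pos by (auto intro!: derivative_eq_intros simp: w_def mult_less_0_iff)
    also have "(- 2 * x * u) * (inverse (sqrt (w * u)) / 2) = - (x / w) * sqrt (w * u)"
      using w u_pos by (simp add: field_simps)
    finally show ?thesis .
  qed
  have "(b has_real_derivative (- (x / w) * sqrt (w * u) * h - sqrt (w * u) * (- 2 * x)) / (h * h)) (at x)"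
  proof -
    have "((\<lambda>x. 1 - x\<^sup>2) has_real_derivative - 2 * x) (at x)"
      by (auto intro!: derivative_eq_intros)
    from DERIV_divide[OF s this] show ?thesis
      unfolding b_eq[THEN ext] using w by (simp add: w_def h_def)
  qed
  also have "(- (x / w) * sqrt (w * u) * h - sqrt (w * u) * (- 2 * x)) / (h * h) = - 2 * \<mu> x * b x"
    unfolding \<mu>_def b_eq w_def[symmetric] h_def[symmetric] using w by (simp add: divide_simps) (simp add: algebra_simps)
  finally have "(b has_real_derivative - 2 * \<mu> x * b x) (at x)" .
  hence "((\<lambda>x. sqrt (b x)) has_real_derivative (- 2 * \<mu> x * b x) * (inverse (sqrt (b x)) / 2)) (at x)"
    using b_pos by (auto intro!: derivative_eq_intros)
  also have "(- 2 * \<mu> x * b x) * (inverse (sqrt (b x)) / 2) = - \<mu> x * sqrt (b x)"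
    using b_pos by (simp add: field_simps)
  finally show ?thesis .
qed

lemma deriv_g: "(func_g k \<alpha> has_real_derivative b x * G x) (at x)"
proof -
  have "(func_g k \<alpha> has_real_derivative
     (- \<mu> x * sqrt (b x) * \<omega> x + sqrt (b x) * (- \<sigma> x * \<omega> x)) * jacobi_P k \<alpha> \<alpha> x + sqrt (b x) * \<omega> x * ultra_deriv k \<alpha> x) (at x)"
    unfolding g_eq[THEN ext]
    using DERIV_mult[OF DERIV_mult[OF deriv_sqrt_b deriv_\<omega>] has_derivative_jacobi_P[of k \<alpha> x]] by (simp add: mult_ac)
  also have "(- \<mu> x * sqrt (b x) * \<omega> x + sqrt (b x) * (- \<sigma> x * \<omega> x)) * jacobi_P k \<alpha> \<alpha> x + sqrt (b x) * \<omega> x * ultra_deriv k \<alpha> x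
     = b x * G x"
  proof -
    have "b x * G x = (b x / sqrt (b x)) * (\<omega> x * (ultra_deriv k \<alpha> x - (\<mu> x + \<sigma> x) * jacobi_P k \<alpha> \<alpha> x))"
      by (simp add: G_def)
    also have "b x / sqrt (b x) = sqrt (b x)" using b_pos by (simp add: real_div_sqrt)
    finally have "b x * G x = sqrt (b x) * (\<omega> x * (ultra_deriv k \<alpha> x - (\<mu> x + \<sigma> x) * jacobi_P k \<alpha> \<alpha> x))" .
    thus ?thesis by (simp add: algebra_simps)
  qed
  finally show ?thesis .
qed

text \<open>
  The third claim identifies the defect: \<open>\<mu>\<close> is the logarithmic derivative of \<open>f = 1 / sqrt b\<close>, so \<open>f'' / f\<close> is
  \<open>\<mu>\<^sup>2 + \<mu>'\<close>. The fourth one says that the factor \<open>\<omega>\<close> brings the ultraspherical equation into the normal form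
  \<open>z'' + b\<^sup>2 z = 0\<close>.
\<close>

lemma deriv_\<mu>_\<sigma>:
  defines "\<mu>' \<equiv> (c + x\<^sup>2) / (2 * (c - x\<^sup>2)\<^sup>2) - (1 + x\<^sup>2) / (1 - x\<^sup>2)\<^sup>2"
    and "\<sigma>' \<equiv> (\<alpha> + 1) * (1 + x\<^sup>2) / (1 - x\<^sup>2)\<^sup>2"
  shows "(\<mu> has_real_derivative \<mu>') (at x)" "(\<sigma> has_real_derivative \<sigma>') (at x)"
    "(b x)\<^sup>2 * (freq u c x - 1) = (\<mu> x)\<^sup>2 + \<mu>'"
    "(\<sigma> x)\<^sup>2 - \<sigma>' + (b x)\<^sup>2 = real k * (real k + 2 * \<alpha> + 1) / (1 - x\<^sup>2)"
proof -
  have nz: "c - x\<^sup>2 \<noteq> 0" "1 - x\<^sup>2 \<noteq> 0" using x1 xc by auto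
  have q: "((\<lambda>x. x / (d - x\<^sup>2)) has_real_derivative (d + x\<^sup>2) / (d - x\<^sup>2)\<^sup>2) (at x)" if "d - x\<^sup>2 \<noteq> 0" for d
    using that by (auto intro!: derivative_eq_intros simp: power2_eq_square)
  have e: "\<mu> = (\<lambda>x. x / (c - x\<^sup>2) / 2 - x / (1 - x\<^sup>2))" "\<sigma> = (\<lambda>x. (\<alpha> + 1) * (x / (1 - x\<^sup>2)))"
    by (simp_all add: \<mu>_def \<sigma>_def fun_eq_iff mult.commute)
  show "(\<mu> has_real_derivative \<mu>') (at x)"
    using DERIV_diff[OF DERIV_cdivide[OF q[OF nz(1)], of 2] q[OF nz(2)]] by (simp add: e \<mu>'_def mult.commute)
  show "(\<sigma> has_real_derivative \<sigma>') (at x)"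
    using DERIV_cmult[OF q[OF nz(2)], of "\<alpha> + 1"] by (simp add: e \<sigma>'_def)
  define w h where "w = c - x\<^sup>2" and "h = 1 - x\<^sup>2"
  have wh: "w \<noteq> 0" "h \<noteq> 0" using nz by (simp_all add: w_def h_def)
  show "(b x)\<^sup>2 * (freq u c x - 1) = (\<mu> x)\<^sup>2 + \<mu>'"
  proof -
    have "(b x)\<^sup>2 * (freq u c x - 1) = defect_num c (x\<^sup>2) / (4 * h\<^sup>2 * w\<^sup>2)"
      unfolding b_sq freq_def w_def[symmetric] h_def[symmetric] using wh u_pos
      by (simp add: divide_simps) (simp add: power_numeral_reduce)
    also have "defect_num c (x\<^sup>2) = x\<^sup>2 * (h - 2 * w)\<^sup>2 + 2 * h\<^sup>2 * (c + x\<^sup>2) - 4 * w\<^sup>2 * (1 + x\<^sup>2)"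
      unfolding defect_num_def w_def h_def by (simp add: algebra_simps power_numeral_reduce)
    also have "\<dots> / (4 * h\<^sup>2 * w\<^sup>2) = (x / (2 * w) - x / h)\<^sup>2 + ((c + x\<^sup>2) / (2 * w\<^sup>2) - (1 + x\<^sup>2) / h\<^sup>2)"
      using wh by (simp add: divide_simps) (simp add: algebra_simps power_numeral_reduce)
    finally show ?thesis by (simp add: \<mu>_def \<mu>'_def w_def h_def)
  qed
  show "(\<sigma> x)\<^sup>2 - \<sigma>' + (b x)\<^sup>2 = real k * (real k + 2 * \<alpha> + 1) / (1 - x\<^sup>2)"
  proof -
    have "(\<sigma> x)\<^sup>2 - \<sigma>' + (b x)\<^sup>2 = ((\<alpha> + 1)\<^sup>2 * x\<^sup>2 - (\<alpha> + 1) * (1 + x\<^sup>2) + (u * c - u * x\<^sup>2)) / h\<^sup>2"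
      unfolding b_sq \<sigma>_def \<sigma>'_def h_def[symmetric]
        power_divide power_mult_distrib add_divide_distrib[symmetric] diff_divide_distrib[symmetric]
      by (simp add: algebra_simps)
    also have "(\<alpha> + 1)\<^sup>2 * x\<^sup>2 - (\<alpha> + 1) * (1 + x\<^sup>2) + (u * c - u * x\<^sup>2) = real k * (real k + 2 * \<alpha> + 1) * h"
      unfolding u_c unfolding u param_u_def h_def by (simp add: algebra_simps power2_eq_square)
    finally show ?thesis using wh by (simp add: h_def power2_eq_square)
  qed
qed

lemma deriv_G: "(G has_real_derivative - b x * freq u c x * func_g k \<alpha> x) (at x)"
proof -
  define \<mu>' where "\<mu>' = (c + x\<^sup>2) / (2 * (c - x\<^sup>2)\<^sup>2) - (1 + x\<^sup>2) / (1 - x\<^sup>2)\<^sup>2"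
  define \<sigma>' where "\<sigma>' = (\<alpha> + 1) * (1 + x\<^sup>2) / (1 - x\<^sup>2)\<^sup>2"
  note d = deriv_\<mu>_\<sigma>[folded \<mu>'_def \<sigma>'_def]
  define V where "V = \<omega> x / sqrt (b x)"
  define P P1 P2 where P: "P = jacobi_P k \<alpha> \<alpha> x" "P1 = ultra_deriv k \<alpha> x" "P2 = ultra_deriv2 k \<alpha> x"
  have "((\<lambda>x. \<omega> x / sqrt (b x)) has_real_derivative
      (- \<sigma> x * \<omega> x * sqrt (b x) - \<omega> x * (- \<mu> x * sqrt (b x))) / (sqrt (b x) * sqrt (b x))) (at x)"
    using b_pos by (intro DERIV_divide deriv_\<omega> deriv_sqrt_b) auto
  also have "(- \<sigma> x * \<omega> x * sqrt (b x) - \<omega> x * (- \<mu> x * sqrt (b x))) / (sqrt (b x) * sqrt (b x)) = (\<mu> x - \<sigma> x) * V"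
    unfolding V_def using b_pos by (simp add: divide_simps) (simp add: algebra_simps)
  finally have V: "((\<lambda>x. \<omega> x / sqrt (b x)) has_real_derivative (\<mu> x - \<sigma> x) * V) (at x)" .
  have "(G has_real_derivative (\<mu> x - \<sigma> x) * V * (P1 - (\<mu> x + \<sigma> x) * P) + V * (P2 - ((\<mu>' + \<sigma>') * P + (\<mu> x + \<sigma> x) * P1))) (at x)"
    unfolding G_def[abs_def] V_def P
    by (rule derivative_eq_intros V[unfolded V_def] d has_derivative_jacobi_P has_derivative_ultra_deriv refl)+ simp
  also have "(\<mu> x - \<sigma> x) * V * (P1 - (\<mu> x + \<sigma> x) * P) + V * (P2 - ((\<mu>' + \<sigma>') * P + (\<mu> x + \<sigma> x) * P1))
    = V * (P2 - 2 * \<sigma> x * P1 + ((\<sigma> x)\<^sup>2 - \<sigma>' + (b x)\<^sup>2 - ((\<mu> x)\<^sup>2 + \<mu>') - (b x)\<^sup>2) * P)"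
    by (simp add: algebra_simps power2_eq_square)
  also have "\<dots> = V * (P2 - 2 * \<sigma> x * P1 + real k * (real k + 2 * \<alpha> + 1) / (1 - x\<^sup>2) * P - (b x)\<^sup>2 * freq u c x * P)"
    unfolding d(4) d(3)[symmetric] by (simp add: algebra_simps)
  also have "P2 - 2 * \<sigma> x * P1 + real k * (real k + 2 * \<alpha> + 1) / (1 - x\<^sup>2) * P
      = ((1 - x\<^sup>2) * P2 - 2 * (\<alpha> + 1) * x * P1 + real k * (real k + 2 * \<alpha> + 1) * P) / (1 - x\<^sup>2)"
    using x1 by (simp add: \<sigma>_def add_divide_distrib diff_divide_distrib)
  also have "\<dots> = 0" unfolding P ultra_ode by simp
  also have "V * (0 - (b x)\<^sup>2 * freq u c x * P) = - b x * freq u c x * ((b x / sqrt (b x)) * \<omega> x * P)"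
    by (simp add: V_def power2_eq_square)
  also have "\<dots> = - b x * freq u c x * func_g k \<alpha> x"
    using b_pos by (simp add: g_eq P real_div_sqrt)
  finally show ?thesis .
qed

end

lemma G_0: "G 0 = 0"
  using k by (simp add: G_def \<mu>_def \<sigma>_def ultra_deriv_0)

lemma g_0: "func_g k \<alpha> 0 = (- 1 / 4) ^ (k div 2) * ((real k + \<alpha>) gchoose (k div 2))
            * ((real k)\<^sup>2 + 2 * real k * \<alpha> + real k + \<alpha> + 1) powr (1 / 4)"
proof -
  have "sqrt (sqrt (c * u)) = (u * c) powr (1 / 4)"
    using u_pos c_pos by (simp add: mult.commute powr_powr flip: powr_half_sqrt)
  thus ?thesis unfolding g_eq \<omega>_def b_eq jacobi_P_0[OF k(2)] u_c[symmetric] by simp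
qed

text \<open>
  The binomial coefficient does not vanish since \<open>k + \<alpha> \<ge> k/2 - 1/4\<close> exceeds all the numbers
  \<open>0, \<dots>, k/2 - 1\<close> that are subtracted from it.
\<close>

lemma g_0_nonzero: "func_g k \<alpha> 0 \<noteq> 0"
proof -
  obtain m where m: "k = 2 * m" using k by blast
  have "(\<Prod>i = 0..<m. real k + \<alpha> - real i) > 0"
  proof (rule prod_pos)
    fix i assume "i \<in> {0..<m}"
    hence "real i + 1 \<le> real m" by simp
    thus "real k + \<alpha> - real i > 0" using \<alpha> m by simp
  qed
  hence "(real k + \<alpha>) gchoose m > 0"
    unfolding gbinomial_prod_rev by (intro divide_pos_pos) auto
  hence "(real k + \<alpha>) gchoose m \<noteq> 0" by simp
  moreover have "u * c \<noteq> 0" using u_pos c_pos by simp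
  ultimately show ?thesis unfolding g_0 u_c[symmetric] using m by simp
qed

end

section \<open>Bounds for the defect\<close>

text \<open>
  The delicate points lie near \<open>c = 1\<close>, \<open>x\<^sup>2 = 1\<close>. In the coordinates \<open>d = 1 - c\<close>, \<open>h = 1 - x\<^sup>2\<close> centred there,
  the numerator starts with a quadratic form, and \<open>c - x\<^sup>2 = h - d\<close>.
\<close>

lemma defect_num_shift:
  "defect_num (1 - d) (1 - h) = - 4 * d\<^sup>2 + 12 * d * h - 3 * h\<^sup>2 - 6 * d * h\<^sup>2 + h ^ 3"
  by (simp add: defect_num_def algebra_simps power_numeral_reduce)

text \<open>
  This bound and the next two compare \<open>b \<bar>p - 1\<bar>\<close> with the derivative of the claimed error bound, after all
  common factors have been removed. For \<open>c \<le> 1/2\<close> the numerator is nonnegative, and its distance to the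
  right-hand side is a sum of nonnegative terms.
\<close>

lemma defect_num_bound_c_le_half:
  assumes "0 < c" "c \<le> 1 / 2" "0 \<le> y" "y < c"
  shows "\<bar>defect_num c y\<bar> < (2 - c) * (c + 2 * y) * (1 - y)"
proof -
  have "(1 - c) * y \<le> (1 - c) * c" using assms by (intro mult_left_mono) auto
  moreover have "(1 - c) * c \<le> 1 / 4"
    using zero_le_power2[of "c - 1 / 2"] by (simp add: algebra_simps power2_eq_square)
  moreover have "y * y \<le> 1 / 2 * (1 / 2)" using assms by (intro mult_mono) auto
  ultimately have "0 \<le> 3 - 6 * ((1 - c) * y) - y * y" by linarith
  hence "0 \<le> y * (3 - 6 * ((1 - c) * y) - y * y)"
    using assms by (intro mult_nonneg_nonneg) auto
  moreover have "0 \<le> 2 * c * (1 - 2 * c)" using assms by (intro mult_nonneg_nonneg) auto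
  moreover have "defect_num c y = 2 * c * (1 - 2 * c) + y * (3 - 6 * ((1 - c) * y) - y * y)"
    by (simp add: defect_num_def algebra_simps power_numeral_reduce)
  ultimately have "0 \<le> defect_num c y" by linarith
  moreover have "(2 - c) * (c + 2 * y) * (1 - y) - defect_num c y = 3 * c\<^sup>2 * (1 - y) + y * (1 - 2 * c + y)\<^sup>2"
    by (simp add: defect_num_def algebra_simps power_numeral_reduce)
  moreover have "0 < 3 * c\<^sup>2 * (1 - y)" using assms by simp
  moreover have "0 \<le> y * (1 - 2 * c + y)\<^sup>2" using assms by simp
  ultimately show ?thesis by linarith
qed

text \<open>
  Both signs of the numerator occur for \<open>c < 1\<close>: it is negative near \<open>y = 0\<close>, while at the turning point
  \<open>y = c\<close> it equals \<open>5 c (1 - c)\<^sup>2\<close>.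
\<close>

lemma defect_num_bound_c_gt_half:
  assumes "1 / 2 < c" "c \<le> 1" "0 \<le> y" "y < c"
  shows "c * \<bar>defect_num c y\<bar> < 4 * (c + (2 - 3 * c) * y) * (1 - y)"
proof -
  define d h where dh: "d = 1 - c" "h = 1 - y"
  have cy: "c = 1 - d" "y = 1 - h" by (simp_all add: dh)
  have d: "0 \<le> d" "d < 1 / 2" "d < h" "h \<le> 1" using assms by (simp_all add: dh)
  define B where "B = 4 * (c + (2 - 3 * c) * y) * (1 - y)"
  have B: "B = 8 * d * h + 4 * h\<^sup>2 - 12 * d * h\<^sup>2"
    by (simp add: B_def cy algebra_simps power2_eq_square)
  have h: "0 < h" using d by linarith
  have h3: "h ^ 3 \<le> h\<^sup>2" using d h by (intro power_decreasing) auto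
  have "d * h\<^sup>2 \<le> 1 / 2 * h\<^sup>2" using d by (intro mult_right_mono) auto
  moreover have "0 \<le> 4 * d\<^sup>2 - 4 * (d * h) + h\<^sup>2"
    using zero_le_power2[of "2 * d - h"] by (simp add: power2_diff power_mult_distrib)
  moreover have "0 < h\<^sup>2" using h by simp
  ultimately have "0 < 4 * d\<^sup>2 - 4 * (d * h) + 7 * h\<^sup>2 - 6 * (d * h\<^sup>2) - h ^ 3"
    using h3 by linarith
  hence upper: "defect_num c y < B"
    unfolding B cy defect_num_shift by (simp add: algebra_simps)
  have "0 < 18 * d * h * (1 - h) - d * h + h ^ 3"
  proof (cases "h \<le> 9 / 10")
    case True
    have "0 \<le> d * h * (18 * (1 - h) - 1)" using True d h by (intro mult_nonneg_nonneg) auto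
    moreover have "0 < h ^ 3" using h by simp
    moreover have "18 * d * h * (1 - h) - d * h = d * h * (18 * (1 - h) - 1)"
      by (simp add: algebra_simps)
    ultimately show ?thesis by linarith
  next
    case False
    have "0 \<le> 18 * d * h * (1 - h)" using d h by simp
    moreover have "d * h \<le> 1 / 2 * h" using d h by (intro mult_right_mono) auto
    moreover have "(9 / 10)\<^sup>2 * h \<le> h\<^sup>2 * h" using False h by (intro mult_right_mono power_mono) auto
    moreover have "(9 / 10)\<^sup>2 * h = 81 / 100 * h" "h\<^sup>2 * h = h ^ 3"
      by (simp_all add: power_numeral_reduce)
    ultimately show ?thesis using h by linarith
  qed
  moreover have "d * d \<le> d * h" "d * d \<le> h * h" using d h by (auto intro!: mult_mono)
  ultimately have "0 < 20 * d * h + h\<^sup>2 - 18 * d * h\<^sup>2 - 4 * d\<^sup>2 + h ^ 3"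
    by (simp add: algebra_simps power2_eq_square)
  hence lower: "- defect_num c y < B"
    unfolding B cy defect_num_shift by (simp add: algebra_simps)
  have "c * \<bar>defect_num c y\<bar> \<le> \<bar>defect_num c y\<bar>"
    using assms by (intro mult_left_le_one_le) auto
  thus ?thesis using upper lower unfolding B_def by linarith
qed

text \<open>
  The numerator is negative here. The square roots disappear on squaring, and the remaining inequality of
  degree 5 in \<open>h = 1 - y\<close> and \<open>d = c - 1\<close> holds coefficient by coefficient, where \<open>10.88\<^sup>2 > 118\<close>.
\<close>

lemma defect_num_bound_c_gt_1:
  assumes "1 < c" "0 \<le> y" "y < 1"
  shows "sqrt 6 * \<bar>defect_num c y\<bar> * sqrt (1 - y) < 10.88 * ((c - y)\<^sup>2 * sqrt (c - y))"
proof -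
  define d h where dh: "d = c - 1" "h = 1 - y"
  have cy: "c = 1 - (- d)" "y = 1 - h" and cy': "c - y = h + d" by (simp_all add: dh)
  have d: "0 < d" "0 < h" "h \<le> 1" using assms by (simp_all add: dh)
  define N where "N = \<bar>defect_num c y\<bar>"
  have h3: "h ^ 3 \<le> h\<^sup>2" using d by (intro power_decreasing) auto
  have "d * h\<^sup>2 \<le> d * h" using d by (simp add: power2_eq_square mult_left_le)
  hence N: "N = 4 * d\<^sup>2 + 12 * d * h + 3 * h\<^sup>2 - 6 * d * h\<^sup>2 - h ^ 3"
  proof -
    have "0 < d * h" "0 \<le> d\<^sup>2" "0 < h\<^sup>2" using d by simp_all
    moreover have "defect_num c y = - 4 * d\<^sup>2 - 12 * (d * h) - 3 * h\<^sup>2 + 6 * (d * h\<^sup>2) + h ^ 3"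
      unfolding cy defect_num_shift by simp
    ultimately have "defect_num c y \<le> 0" using h3 \<open>d * h\<^sup>2 \<le> d * h\<close> by linarith
    thus ?thesis unfolding N_def cy defect_num_shift by simp
  qed
  have N0: "0 \<le> N" by (simp add: N_def)
  have "0 < d * h\<^sup>2" "0 < h ^ 3" using d by auto
  hence "N < 3 * h\<^sup>2 + 12 * d * h + 4 * d\<^sup>2" unfolding N by linarith
  hence "N\<^sup>2 < (3 * h\<^sup>2 + 12 * d * h + 4 * d\<^sup>2)\<^sup>2" using N0 by (intro power_strict_mono) auto
  hence "6 * N\<^sup>2 * h < 6 * (3 * h\<^sup>2 + 12 * d * h + 4 * d\<^sup>2)\<^sup>2 * h" using d by simp
  also have "\<dots> = 54 * h ^ 5 + 432 * (d * h ^ 4) + 1008 * (d ^ 2 * h ^ 3) + 576 * (d ^ 3 * h ^ 2) + 96 * (d ^ 4 * h)"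
    by (simp add: algebra_simps power_numeral_reduce)
  also have "\<dots> \<le> 118 * h ^ 5 + 590 * (d * h ^ 4) + 1180 * (d ^ 2 * h ^ 3) + 1180 * (d ^ 3 * h ^ 2) + 590 * (d ^ 4 * h) + 118 * d ^ 5"
    using d by (intro add_mono mult_right_mono order_trans[OF _ le_add_same_cancel1[THEN iffD2]]) auto
  also have "\<dots> = 118 * (h + d) ^ 5"
    by (simp add: algebra_simps power_numeral_reduce)
  also have "\<dots> \<le> 10.88\<^sup>2 * (h + d) ^ 5" using d by (intro mult_right_mono) (auto simp: power2_eq_square)
  finally have "sqrt (6 * N\<^sup>2 * h) < sqrt (10.88\<^sup>2 * (((h + d)\<^sup>2)\<^sup>2 * (h + d)))"
    by (simp add: power_numeral_reduce mult_ac)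
  moreover have "sqrt ((h + d) ^ 4) = (h + d)\<^sup>2" by (rule real_sqrt_unique) simp_all
  ultimately show ?thesis using N0 by (simp add: real_sqrt_mult N_def[symmetric] cy' dh(2)[symmetric])
qed

lemma freq_ge_if:
  assumes "0 < u" "y < c" "y = x\<^sup>2" "0 \<le> defect_num c y + (1 - m) * 4 * u * (c - y) ^ 3"
  shows "m \<le> freq u c x"
  using assms by (simp add: freq_def field_simps)

text \<open>
  As \<open>1/u \<le> 1 - x\<^sup>2\<close>, the parameter \<open>u\<close> may be replaced by \<open>1 / (1 - x\<^sup>2)\<close>; multiplying by \<open>h = 1 - x\<^sup>2\<close> leaves
  a polynomial inequality in \<open>d = c - 1\<close> and \<open>h\<close>.
\<close>

lemma freq_ge_sixth_c_gt_1:
  assumes "1 < c" "0 < u" "x\<^sup>2 < 1" "1 \<le> u * (1 - x\<^sup>2)"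
  shows "1 / 6 \<le> freq u c x"
proof (rule freq_ge_if[OF assms(2) _ refl])
  define d h where dh: "d = c - 1" "h = 1 - x\<^sup>2"
  have cy: "c = 1 - (- d)" "x\<^sup>2 = 1 - h" and cy': "c - x\<^sup>2 = h + d" by (simp_all add: dh)
  have d: "0 < d" "0 < h" "1 \<le> u * h" using assms by (simp_all add: dh)
  have "0 \<le> h * ((h - 3 * d)\<^sup>2 + 9 * d\<^sup>2) + 10 * d ^ 3 + 18 * (d * h ^ 3) + 3 * h ^ 4" using d by simp
  also have "\<dots> = 3 * (h * defect_num c (x\<^sup>2)) + 10 * (h + d) ^ 3"
    unfolding cy defect_num_shift by (simp add: algebra_simps power_numeral_reduce)
  also have "10 * (h + d) ^ 3 \<le> (u * h) * (10 * (h + d) ^ 3)"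
    using d by (subst mult_le_cancel_right1) auto
  finally have "0 \<le> h * (defect_num c (x\<^sup>2) + (1 - 1 / 6) * 4 * u * (h + d) ^ 3)"
    by (simp add: algebra_simps)
  thus "0 \<le> defect_num c (x\<^sup>2) + (1 - 1 / 6) * 4 * u * (c - x\<^sup>2) ^ 3"
    using d by (simp add: cy' zero_le_mult_iff)
qed (use assms in simp)

text \<open>
  The case \<open>1 \<le> \<alpha>\<^sup>2 \<le> 7/6\<close>: the two assumptions on \<open>u\<close> give \<open>6 d \<le> h\<close> for \<open>d = 1 - c\<close> and \<open>h = 1 - x\<^sup>2\<close>, so \<open>x\<close> is
  far from the turning point on the scale of \<open>d\<close>. For \<open>c = 1\<close> and large \<open>u\<close> the constant \<open>1/4\<close> is the limit at the
  end point \<open>h = 1/u\<close>.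
\<close>

lemma freq_ge_quarter_away_from_1:
  assumes "c \<le> 1" "0 < u" "x\<^sup>2 < c" "1 \<le> u * (1 - x\<^sup>2)" "u * (1 - c) \<le> 1 / 6"
  shows "1 / 4 \<le> freq u c x"
proof (rule freq_ge_if[OF assms(2,3) refl])
  define d h where dh: "d = 1 - c" "h = 1 - x\<^sup>2"
  have cy: "c = 1 - d" "x\<^sup>2 = 1 - h" and cy': "c - x\<^sup>2 = h - d" by (simp_all add: dh)
  have d: "0 \<le> d" "d < h" "1 \<le> u * h" "u * d \<le> 1 / 6" using assms by (simp_all add: dh)
  hence h: "0 < h" by linarith
  have "u * (6 * d) \<le> u * h" using d by linarith
  hence 6: "6 * d \<le> h" using assms(2) by simp
  have "d * d * d \<le> d * d * h" using d by (intro mult_left_mono) auto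
  hence "0 \<le> 3 * d * h\<^sup>2 + 2 * d\<^sup>2 * h + 3 * (d\<^sup>2 * h - d ^ 3) + h ^ 3 * (h - 6 * d)" using d h 6
    by (intro add_nonneg_nonneg) (auto simp: power2_eq_square power3_eq_cube)
  also have "\<dots> = h * defect_num c (x\<^sup>2) + 3 * (h - d) ^ 3"
    unfolding cy defect_num_shift by (simp add: algebra_simps power_numeral_reduce)
  also have "3 * (h - d) ^ 3 \<le> (u * h) * (3 * (h - d) ^ 3)"
    using d by (subst mult_le_cancel_right1) auto
  finally have "0 \<le> h * (defect_num c (x\<^sup>2) + (1 - 1 / 4) * 4 * u * (h - d) ^ 3)"
    by (simp add: algebra_simps)
  thus "0 \<le> defect_num c (x\<^sup>2) + (1 - 1 / 4) * 4 * u * (c - x\<^sup>2) ^ 3"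
    using h by (simp add: cy' zero_le_mult_iff)
qed

text \<open>
  The case \<open>\<alpha>\<^sup>2 \<ge> 7/6\<close>: now \<open>u\<close> may be replaced by \<open>1 / (6 (1 - c))\<close>, and \<open>x\<close> may come arbitrarily close to the
  turning point.
\<close>

lemma freq_ge_quarter_large_order:
  assumes "3 / 4 \<le> c" "0 < u" "x\<^sup>2 < c" "1 / 6 \<le> u * (1 - c)"
  shows "1 / 4 \<le> freq u c x"
proof (rule freq_ge_if[OF assms(2,3) refl])
  define d w where dw: "d = 1 - c" "w = c - x\<^sup>2"
  have cy: "c = 1 - d" "x\<^sup>2 = 1 - (d + w)" by (simp_all add: dw)
  have "0 < u * (1 - c)" using assms by linarith
  hence d: "0 < d" "d \<le> 1 / 4" "0 < w" "1 / 6 \<le> u * d" using assms by (simp_all add: dw zero_less_mult_iff)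
  \<comment> \<open>The sum is \<open>2 * d\<close> times the numerator plus \<open>w ^ 3\<close>. Its first two summands together are positive,
    so only \<open>w < 5 * d\<close> needs work.\<close>
  have "0 \<le> (w - 2 * d) ^ 3 + 18 * d ^ 3 + 2 * d * ((w - 5 * d) * (w + d)\<^sup>2)"
  proof (cases "5 * d \<le> w")
    case True thus ?thesis using d by simp
  next
    case False
    \<comment> \<open>Bounding the factor \<open>2 * d\<close> by \<open>1/2\<close> and putting \<open>w = r * d\<close> leaves a multiple of
      \<open>r\<^sup>3 - 5 r\<^sup>2 + 5 r + 5\<close>, whose minimum over \<open>r \<ge> 0\<close> is close to \<open>27/10\<close>; hence the square.\<close>
    have "0 \<le> 3 / 2 * ((w - 27 / 10 * d)\<^sup>2 * (w + 2 / 5 * d) + d\<^sup>2 * (521 / 250 * d - 13 / 100 * w))"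
      using False d by (intro add_nonneg_nonneg mult_nonneg_nonneg) auto
    also have "\<dots> = (w - 2 * d) ^ 3 + 18 * d ^ 3 + 1 / 2 * ((w - 5 * d) * (w + d)\<^sup>2)"
      by (simp add: field_simps power_numeral_reduce)
    also have "1 / 2 * ((w - 5 * d) * (w + d)\<^sup>2) \<le> 2 * d * ((w - 5 * d) * (w + d)\<^sup>2)"
      using False d by (intro mult_right_mono_neg) (auto intro: mult_nonpos_nonneg)
    finally show ?thesis by simp
  qed
  also have "\<dots> = 2 * d * defect_num c (x\<^sup>2) + w ^ 3"
    unfolding cy defect_num_shift by (simp add: algebra_simps power_numeral_reduce)
  also have "w ^ 3 \<le> (6 * (u * d)) * w ^ 3"
    using d by (subst mult_le_cancel_right1) auto
  finally have "0 \<le> 2 * d * (defect_num c (x\<^sup>2) + (1 - 1 / 4) * 4 * u * w ^ 3)"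
    by (simp add: algebra_simps)
  thus "0 \<le> defect_num c (x\<^sup>2) + (1 - 1 / 4) * 4 * u * (c - x\<^sup>2) ^ 3"
    using d by (simp add: dw(2)[symmetric] zero_le_mult_iff)
qed

text \<open>
  For \<open>c \<le> 3/4\<close> the sign change described by \<open>deriv_freq\<close> does not happen at positive \<open>x\<close>.
\<close>

lemma freq_increasing:
  assumes "0 < c" "c \<le> 3 / 4" "0 < u" "0 \<le> x" "x\<^sup>2 < c"
  shows "freq u c 0 \<le> freq u c x"
proof (rule DERIV_nonneg_imp_nondecreasing[OF assms(4)])
  fix s assume s: "0 \<le> s" "s \<le> x"
  hence "s\<^sup>2 \<le> x\<^sup>2" by (intro power_mono) auto
  hence sc: "s\<^sup>2 < c" using assms by simp
  show "\<exists>y. (freq u c has_real_derivative y) (at s) \<and> 0 \<le> y"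
  proof (intro exI conjI)
    show "(freq u c has_real_derivative 6 * s * (1 - s\<^sup>2) * ((2 - c) * s\<^sup>2 - c * (4 * c - 3)) / (4 * u * (c - s\<^sup>2) ^ 4)) (at s)"
      by (rule deriv_freq[OF sc assms(3)])
    have "c * (4 * c - 3) \<le> 0" using assms by (intro mult_nonneg_nonpos) auto
    moreover have "0 \<le> (2 - c) * s\<^sup>2" using assms by simp
    ultimately have "0 \<le> (2 - c) * s\<^sup>2 - c * (4 * c - 3)" by linarith
    thus "0 \<le> 6 * s * (1 - s\<^sup>2) * ((2 - c) * s\<^sup>2 - c * (4 * c - 3)) / (4 * u * (c - s\<^sup>2) ^ 4)"
      using s sc assms by (intro divide_nonneg_nonneg mult_nonneg_nonneg[of "6 * s * (1 - s\<^sup>2)"]) auto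
  qed
qed

lemma deriv_div_sqrt:
  fixes x :: real
  assumes "x\<^sup>2 < 1"
  shows "((\<lambda>x. x / sqrt (1 - x\<^sup>2)) has_real_derivative 1 / ((1 - x\<^sup>2) * sqrt (1 - x\<^sup>2))) (at x)"
proof -
  define h where "h = 1 - x\<^sup>2"
  have h: "0 < h" using assms by (simp add: h_def)
  have r: "((\<lambda>x. sqrt (1 - x\<^sup>2)) has_real_derivative - x / sqrt h) (at x)"
    using h by (auto intro!: derivative_eq_intros simp: h_def divide_simps)
  have "(1 * sqrt h - x * (- x / sqrt h)) / (sqrt h * sqrt h) = 1 / (h * sqrt h)"
    using h by (simp add: divide_simps) (simp add: h_def power2_eq_square)
  thus ?thesis using DERIV_divide[OF DERIV_ident r] h by (simp add: h_def)
qed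

lemma deriv_powr_quotient:
  fixes F :: "real \<Rightarrow> real"
  assumes F: "(F has_real_derivative F') (at x)" and x: "x\<^sup>2 < c"
  shows "((\<lambda>x. F x / (c - x\<^sup>2) powr (3 / 2)) has_real_derivative
      (F' * (c - x\<^sup>2) + 3 * x * F x) / ((c - x\<^sup>2)\<^sup>2 * sqrt (c - x\<^sup>2))) (at x)"
proof -
  define w where "w = c - x\<^sup>2"
  have w: "0 < w" using x by (simp add: w_def)
  have E: "((\<lambda>x. (c - x\<^sup>2) powr (3 / 2)) has_real_derivative - 3 * x * sqrt w) (at x)"
    using w by (auto intro!: derivative_eq_intros simp: w_def powr_half_sqrt)
  have p: "w powr (3 / 2) = w * sqrt w"
    using w powr_add[of w 1 "1 / 2"] by (simp add: powr_half_sqrt)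
  have "(F' * (w * sqrt w) - F x * (- 3 * x * sqrt w)) / (w * sqrt w * (w * sqrt w)) = (F' * w + 3 * x * F x) / (w\<^sup>2 * sqrt w)"
    using w by (simp add: divide_simps) (simp add: algebra_simps power2_eq_square)
  thus ?thesis using DERIV_divide[OF F E] w by (simp add: w_def[symmetric] p)
qed

lemma arccos_sqrt_eq_arcsin:
  assumes "0 \<le> s" "s \<le> 1" "t = 1 - s\<^sup>2"
  shows "arccos (sqrt t) = arcsin s"
proof -
  have "arccos (cos (arcsin s)) = arcsin s"
    using assms arcsin_bounded[of s] arcsin_nonneg[of s] pi_gt_zero by (intro arccos_cos) auto
  thus ?thesis using assms by (simp add: cos_arcsin)
qed

lemma arcosh_sqrt_eq_arsinh:
  fixes s :: real
  assumes "0 \<le> s" "t = s\<^sup>2 + 1"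
  shows "arcosh (sqrt t) = arsinh s"
proof -
  have "0 \<le> arsinh s" using assms by (simp flip: not_less)
  from arcosh_cosh_real[OF this] show ?thesis using assms by (simp add: cosh_arsinh_real)
qed

context ultraspherical
begin

section \<open>The phase\<close>

text \<open>
  At \<open>x = 0\<close> the inverse cosines of the phase are evaluated at 1, where they are not differentiable. Written with
  inverse sines, the phase continues smoothly across 0.
\<close>

definition "\<theta> x = (if c \<le> 1
   then sqrt u * (arcsin (x / sqrt c) - sqrt (1 - c) * arcsin (sqrt (1 - c) / sqrt c * (x / sqrt (1 - x\<^sup>2))))
   else sqrt u * (arcsin (x / sqrt c) + sqrt (c - 1) * arsinh (sqrt (c - 1) / sqrt c * (x / sqrt (1 - x\<^sup>2)))))"

lemma \<theta>_0: "\<theta> 0 = 0"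
  by (simp add: \<theta>_def)

lemma phase_eq:
  assumes "0 \<le> x" "x\<^sup>2 < 1" "x\<^sup>2 < c"
  shows "phase_B k \<alpha> x = \<theta> x"
proof -
  have q: "param_q k \<alpha> = 1 - c" by (simp add: c)
  note cp = c_pos
  have "x / sqrt c \<le> 1" using assms cp by (simp add: real_le_rsqrt)
  hence 1: "arccos (sqrt ((c - x\<^sup>2) / c)) = arcsin (x / sqrt c)"
    using assms cp by (intro arccos_sqrt_eq_arcsin) (simp_all add: power_divide diff_divide_distrib)
  have sq: "(c - x\<^sup>2) / (c * (1 - x\<^sup>2)) = 1 - (1 - c) / c * (x\<^sup>2 / (1 - x\<^sup>2))"
    using assms c_pos by (simp add: divide_simps) (simp add: algebra_simps)
  show ?thesis
  proof (cases "c \<le> 1")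
    case True
    define s where "s = sqrt (1 - c) / sqrt c * (x / sqrt (1 - x\<^sup>2))"
    have s2: "s\<^sup>2 = (1 - c) / c * (x\<^sup>2 / (1 - x\<^sup>2))"
      using True assms c_pos by (simp add: s_def power_divide power_mult_distrib)
    have "0 < (c - x\<^sup>2) / (c * (1 - x\<^sup>2))" using assms c_pos by simp
    hence "s\<^sup>2 < 1" unfolding sq s2 by simp
    hence "\<bar>s\<bar> < 1" by (simp add: abs_square_less_1)
    moreover have "0 \<le> s" using assms True cp by (simp add: s_def)
    ultimately have "arccos (sqrt ((c - x\<^sup>2) / (c * (1 - x\<^sup>2)))) = arcsin s"
      unfolding sq s2[symmetric] by (intro arccos_sqrt_eq_arcsin) auto
    thus ?thesis using True 1 by (simp add: phase_B_def \<theta>_def q u[symmetric] s_def Let_def)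
  next
    case False
    define s where "s = sqrt (c - 1) / sqrt c * (x / sqrt (1 - x\<^sup>2))"
    have s2: "s\<^sup>2 = (c - 1) / c * (x\<^sup>2 / (1 - x\<^sup>2))"
      using False assms c_pos by (simp add: s_def power_divide power_mult_distrib)
    have "arcosh (sqrt ((c - x\<^sup>2) / (c * (1 - x\<^sup>2)))) = arsinh s"
    proof (rule arcosh_sqrt_eq_arsinh)
      show "0 \<le> s" using assms False cp by (simp add: s_def)
      have "(1 - c) / c = - ((c - 1) / c)" by (simp add: minus_divide_left)
      thus "(c - x\<^sup>2) / (c * (1 - x\<^sup>2)) = s\<^sup>2 + 1" unfolding sq s2 by simp
    qed
    thus ?thesis using False 1 by (simp add: phase_B_def \<theta>_def q u[symmetric] s_def Let_def)
  qed
qed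

lemma deriv_\<theta>:
  assumes x: "x\<^sup>2 < 1" "x\<^sup>2 < c"
  shows "(\<theta> has_real_derivative b x) (at x)"
proof -
  define w h where "w = c - x\<^sup>2" and "h = 1 - x\<^sup>2"
  have wh: "0 < w" "0 < h" using x by (simp_all add: w_def h_def)
  note cp = c_pos
  have inner: "((\<lambda>x. x / sqrt (1 - x\<^sup>2)) has_real_derivative 1 / (h * sqrt h)) (at x)"
    unfolding h_def by (rule deriv_div_sqrt[OF x(1)])
  have first: "((\<lambda>x. arcsin (x / sqrt c)) has_real_derivative 1 / sqrt w) (at x)"
  proof -
    have "\<bar>x / sqrt c\<bar> < 1" using x cp by (simp add: abs_divide real_less_rsqrt)
    hence "((\<lambda>x. arcsin (x / sqrt c)) has_real_derivative inverse (sqrt (1 - (x / sqrt c)\<^sup>2)) * (1 / sqrt c)) (at x)"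
      by (intro DERIV_chain2[OF DERIV_arcsin] DERIV_cdivide DERIV_ident) (simp_all only: abs_less_iff, simp_all)
    also have "1 - (x / sqrt c)\<^sup>2 = w / c" using cp by (simp add: w_def field_simps power_divide)
    also have "inverse (sqrt (w / c)) * (1 / sqrt c) = 1 / sqrt w" using cp by (simp add: real_sqrt_divide)
    finally show ?thesis .
  qed
  have b: "b x = sqrt u * (1 / sqrt w - (1 - c) * (1 / (h * sqrt w)))"
  proof -
    have "b x = sqrt u * (w / (h * sqrt w))"
      using wh by (simp add: b_eq w_def[symmetric] h_def[symmetric] real_sqrt_mult real_div_sqrt field_simps)
    also have "w / (h * sqrt w) = 1 / sqrt w - (1 - c) * (1 / (h * sqrt w))"
      using wh by (simp add: divide_simps) (simp add: w_def h_def)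
    finally show ?thesis .
  qed
  show ?thesis
  proof (cases "c \<le> 1")
    case True
    define \<kappa> where "\<kappa> = sqrt (1 - c) / sqrt c"
    define s where "s = \<kappa> * (x / sqrt h)"
    have "s\<^sup>2 = (1 - c) / c * (x\<^sup>2 / h)"
      using True wh cp by (simp add: s_def \<kappa>_def power_divide power_mult_distrib)
    hence s2: "1 - s\<^sup>2 = w / (c * h)"
      using wh cp by (simp add: divide_simps) (simp add: w_def h_def algebra_simps)
    moreover have "0 < w / (c * h)" using wh cp by simp
    ultimately have "s\<^sup>2 < 1" by simp
    hence "\<bar>s\<bar> < 1" by (simp add: abs_square_less_1)
    hence "- 1 < s" "s < 1" by simp_all
    hence "((\<lambda>x. arcsin (\<kappa> * (x / sqrt (1 - x\<^sup>2)))) has_real_derivative inverse (sqrt (1 - s\<^sup>2)) * (\<kappa> * (1 / (h * sqrt h)))) (at x)"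
      unfolding s_def h_def
      by (intro DERIV_chain2[OF DERIV_arcsin] DERIV_cmult inner[unfolded h_def]) assumption+
    also have "inverse (sqrt (1 - s\<^sup>2)) * (\<kappa> * (1 / (h * sqrt h))) = sqrt (1 - c) * (1 / (h * sqrt w))"
      unfolding s2 \<kappa>_def using wh cp by (simp add: real_sqrt_divide real_sqrt_mult)
    finally have "((\<lambda>x. sqrt u * (arcsin (x / sqrt c) - sqrt (1 - c) * arcsin (\<kappa> * (x / sqrt (1 - x\<^sup>2)))))
       has_real_derivative sqrt u * (1 / sqrt w - sqrt (1 - c) * (sqrt (1 - c) * (1 / (h * sqrt w))))) (at x)"
      by (intro DERIV_cmult DERIV_diff first)
    also have "sqrt (1 - c) * (sqrt (1 - c) * (1 / (h * sqrt w))) = (1 - c) * (1 / (h * sqrt w))"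
      using True unfolding mult.assoc[symmetric] by simp
    finally show ?thesis using True unfolding \<theta>_def[abs_def] b \<kappa>_def by simp
  next
    case False
    define \<kappa> where "\<kappa> = sqrt (c - 1) / sqrt c"
    define s where "s = \<kappa> * (x / sqrt h)"
    have "s\<^sup>2 = (c - 1) / c * (x\<^sup>2 / h)"
      using False wh cp by (simp add: s_def \<kappa>_def power_divide power_mult_distrib)
    hence s2: "s\<^sup>2 + 1 = w / (c * h)"
      using wh cp by (simp add: divide_simps) (simp add: w_def h_def algebra_simps)
    have "((\<lambda>x. arsinh (\<kappa> * (x / sqrt (1 - x\<^sup>2)))) has_real_derivative (1 / sqrt (s\<^sup>2 + 1)) * (\<kappa> * (1 / (h * sqrt h)))) (at x)"
      unfolding s_def h_def
      by (intro DERIV_chain2[OF arsinh_real_has_field_derivative] DERIV_cmult inner[unfolded h_def])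
    also have "(1 / sqrt (s\<^sup>2 + 1)) * (\<kappa> * (1 / (h * sqrt h))) = sqrt (c - 1) * (1 / (h * sqrt w))"
      unfolding s2 \<kappa>_def using wh cp by (simp add: real_sqrt_divide real_sqrt_mult)
    finally have "((\<lambda>x. sqrt u * (arcsin (x / sqrt c) + sqrt (c - 1) * arsinh (\<kappa> * (x / sqrt (1 - x\<^sup>2)))))
       has_real_derivative sqrt u * (1 / sqrt w + sqrt (c - 1) * (sqrt (c - 1) * (1 / (h * sqrt w))))) (at x)"
      by (intro DERIV_cmult DERIV_add first)
    also have "1 / sqrt w + sqrt (c - 1) * (sqrt (c - 1) * (1 / (h * sqrt w))) = 1 / sqrt w - (1 - c) * (1 / (h * sqrt w))"
      using False unfolding mult.assoc[symmetric] by (simp add: diff_divide_distrib)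
    finally show ?thesis using False unfolding \<theta>_def[abs_def] b \<kappa>_def by simp
  qed
qed

lemma c_less_2: "c < 2"
proof -
  have "u * (c - 1) \<le> 1" using u_q by (simp add: algebra_simps)
  also have "1 < u * 1" using u_ge by simp
  finally show ?thesis using u_pos by (simp add: mult_less_cancel_left)
qed

section \<open>The error estimates\<close>

text \<open>
  The point where the frequency turns from decreasing to increasing is \<open>sqrt \<eta>\<close>. For \<open>c \<le> 3/4\<close> it is 0, and for
  \<open>c \<ge> 1\<close> it lies to the right of the whole interval, so that all ranges of \<open>c\<close> are covered at once.
\<close>

lemma amplitude:
  assumes x: "0 \<le> x" "x\<^sup>2 < 1" "x\<^sup>2 < c" and "0 < m"
    and lower: "\<And>s. s \<in> {0..x} \<Longrightarrow> m \<le> freq u c s"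
  shows "(func_g k \<alpha> x)\<^sup>2 \<le> freq u c 0 / m * (func_g k \<alpha> 0)\<^sup>2"
proof -
  have sq: "s\<^sup>2 < 1" "s\<^sup>2 < c" if "s \<in> {0..x}" for s
  proof -
    have "s\<^sup>2 \<le> x\<^sup>2" using that by (intro power_mono) auto
    thus "s\<^sup>2 < 1" "s\<^sup>2 < c" using x by linarith+
  qed
  define \<eta> where "\<eta> = max 0 (c * (4 * c - 3) / (2 - c))"
  have c2: "0 < 2 - c" using c_less_2 by simp
  show ?thesis
  proof (rule oscillator_amplitude[OF deriv_g deriv_G deriv_freq[OF _ u_pos] lower, where \<xi> = "sqrt \<eta>"])
    fix s assume s: "s \<in> {0..x}"
    {
      assume "s \<le> sqrt \<eta>"
      hence "s\<^sup>2 \<le> \<eta>" using s by (metis atLeastAtMost_iff power_mono real_sqrt_pow2 \<eta>_def max.cobounded1)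
      hence "s = 0 \<or> (2 - c) * s\<^sup>2 \<le> c * (4 * c - 3)"
        using c2 by (auto simp: \<eta>_def max_def field_simps split: if_splits)
      thus "6 * s * (1 - s\<^sup>2) * ((2 - c) * s\<^sup>2 - c * (4 * c - 3)) / (4 * u * (c - s\<^sup>2) ^ 4) \<le> 0"
      proof
        assume "(2 - c) * s\<^sup>2 \<le> c * (4 * c - 3)"
        thus ?thesis using s sq[OF s] u_pos
          by (intro divide_nonpos_nonneg mult_nonneg_nonpos[of "6 * s * (1 - s\<^sup>2)"]) auto
      qed simp
    }
    {
      assume "sqrt \<eta> \<le> s"
      hence "\<eta> \<le> s\<^sup>2" by (rule sqrt_le_D)
      hence "c * (4 * c - 3) / (2 - c) \<le> s\<^sup>2" by (simp add: \<eta>_def)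
      hence "c * (4 * c - 3) \<le> (2 - c) * s\<^sup>2" using c2 by (simp add: field_simps)
      thus "0 \<le> 6 * s * (1 - s\<^sup>2) * ((2 - c) * s\<^sup>2 - c * (4 * c - 3)) / (4 * u * (c - s\<^sup>2) ^ 4)"
        using s sq[OF s] u_pos by (intro divide_nonneg_nonneg mult_nonneg_nonneg[of "6 * s * (1 - s\<^sup>2)"]) auto
    }
  qed (use sq x G_0 \<open>0 < m\<close> in \<open>auto simp: \<eta>_def\<close>)
qed

text \<open>
  The left-hand side of the last assumption is \<open>b \<bar>p - 1\<bar> M\<close> with the square roots of \<open>b\<close> cancelled.
\<close>

lemma error_less:
  assumes x: "0 < x" "x\<^sup>2 < 1" "x\<^sup>2 < c"
    and R: "\<And>s. s \<in> {0..x} \<Longrightarrow> (R has_real_derivative R' s) (at s)" and "R 0 = 0"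
    and amp: "\<And>s. s \<in> {0..x} \<Longrightarrow> (func_g k \<alpha> s)\<^sup>2 \<le> M\<^sup>2 * (func_g k \<alpha> 0)\<^sup>2" and "0 \<le> M"
    and dens: "\<And>s. s \<in> {0..x} \<Longrightarrow> M * \<bar>defect_num c (s\<^sup>2)\<bar> / (4 * (1 - s\<^sup>2) * ((c - s\<^sup>2)\<^sup>2 * sqrt (c - s\<^sup>2)) * sqrt u) < R' s"
  shows "\<bar>err_r k \<alpha> x\<bar> < R x"
proof -
  let ?g = "func_g k \<alpha>"
  have sq: "s\<^sup>2 < 1" "s\<^sup>2 < c" if "s \<in> {0..x}" for s
  proof -
    have "s\<^sup>2 \<le> x\<^sup>2" using that by (intro power_mono) auto
    thus "s\<^sup>2 < 1" "s\<^sup>2 < c" using x by linarith+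
  qed
  have "\<bar>?g x - ?g 0 * cos (\<theta> x)\<bar> < \<bar>?g 0\<bar> * R x - \<bar>?g 0\<bar> * R 0"
  proof (rule perturbed_oscillator_error[OF x(1) deriv_g deriv_G deriv_\<theta> DERIV_cmult[OF R]])
    fix s assume s: "s \<in> {0..x}"
    define w h where "w = c - s\<^sup>2" and "h = 1 - s\<^sup>2"
    have wh: "0 < w" "0 < h" using sq[OF s] by (simp_all add: w_def h_def)
    have "b s * (freq u c s - 1) = sqrt w * sqrt u / h * (defect_num c (s\<^sup>2) / (4 * u * w ^ 3))"
      by (simp add: b_eq freq_def w_def h_def real_sqrt_mult)
    also have "\<dots> = defect_num c (s\<^sup>2) / (4 * h * (w\<^sup>2 * sqrt w) * sqrt u)"
    proof -
      have "u = sqrt u * sqrt u" "w ^ 3 = w\<^sup>2 * sqrt w * sqrt w" using wh u_pos by (simp_all add: power_numeral_reduce)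
      thus ?thesis using wh u_pos by (simp add: divide_simps)
    qed
    finally have "\<bar>b s * (freq u c s - 1)\<bar> = \<bar>defect_num c (s\<^sup>2)\<bar> / (4 * h * (w\<^sup>2 * sqrt w) * sqrt u)"
      using wh u_pos by (simp add: abs_divide abs_mult)
    moreover have "\<bar>?g s\<bar> \<le> M * \<bar>?g 0\<bar>"
      using amp[OF s] \<open>0 \<le> M\<close> by (intro abs_le_square_iff[THEN iffD2, of _ "M * \<bar>?g 0\<bar>", simplified abs_mult abs_abs abs_of_nonneg[OF \<open>0 \<le> M\<close>]]) (simp add: power_mult_distrib)
    ultimately have "\<bar>b s * (freq u c s - 1) * ?g s\<bar> \<le> \<bar>defect_num c (s\<^sup>2)\<bar> / (4 * h * (w\<^sup>2 * sqrt w) * sqrt u) * (M * \<bar>?g 0\<bar>)"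
      unfolding abs_mult[of _ "?g s"] using wh u_pos by (intro mult_mono) auto
    also have "\<dots> = \<bar>?g 0\<bar> * (M * \<bar>defect_num c (s\<^sup>2)\<bar> / (4 * h * (w\<^sup>2 * sqrt w) * sqrt u))" by simp
    also have "\<dots> < \<bar>?g 0\<bar> * R' s"
      using dens[OF s] g_0_nonzero unfolding w_def h_def by (intro mult_strict_left_mono) auto
    finally show "\<bar>b s * (freq u c s - 1) * ?g s\<bar> < \<bar>?g 0\<bar> * R' s" .
  qed (use sq G_0 \<theta>_0 in auto)
  hence "\<bar>?g x - ?g 0 * cos (\<theta> x)\<bar> < \<bar>?g 0\<bar> * R x" using \<open>R 0 = 0\<close> by simp
  moreover have err: "err_r k \<alpha> x = (?g x - ?g 0 * cos (\<theta> x)) / ?g 0"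
    using g_0_nonzero phase_eq x by (simp add: err_r_def diff_divide_distrib)
  ultimately show ?thesis unfolding err abs_divide
    using g_0_nonzero by (simp add: pos_divide_less_eq mult.commute)
qed

lemma g_sq_le:
  assumes x: "0 < x" "x\<^sup>2 < 1" "x\<^sup>2 < c" and s: "s \<in> {0..x}" and "0 < m"
    and lower: "\<And>s. s \<in> {0..x} \<Longrightarrow> m \<le> freq u c s" and M: "freq u c 0 \<le> M\<^sup>2 * m"
  shows "(func_g k \<alpha> s)\<^sup>2 \<le> M\<^sup>2 * (func_g k \<alpha> 0)\<^sup>2"
proof -
  have "s\<^sup>2 \<le> x\<^sup>2" using s by (intro power_mono) auto
  hence "s\<^sup>2 < 1" "s\<^sup>2 < c" using x by linarith+
  hence "(func_g k \<alpha> s)\<^sup>2 \<le> freq u c 0 / m * (func_g k \<alpha> 0)\<^sup>2"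
    using s lower \<open>0 < m\<close> by (intro amplitude) auto
  also have "\<dots> \<le> M\<^sup>2 * (func_g k \<alpha> 0)\<^sup>2"
    using M \<open>0 < m\<close> by (intro mult_right_mono) (auto simp: field_simps)
  finally show ?thesis .
qed

lemma freq_0: "freq u c 0 = 1 - (2 * c - 1) / (2 * u * c\<^sup>2)"
  using u_pos c_pos by (simp add: freq_def defect_num_def divide_simps) (simp add: algebra_simps power_numeral_reduce)

lemma freq_0_pos: "0 < freq u c 0"
proof -
  have "1 * c\<^sup>2 \<le> u * c\<^sup>2" using u_ge by (intro mult_right_mono) auto
  moreover have "2 * c - 1 \<le> c\<^sup>2" using zero_le_power2[of "c - 1"] by (simp add: power2_diff)
  moreover have "0 < u * c\<^sup>2" using u_pos c_pos by simp
  ultimately have "2 * c - 1 < 2 * u * c\<^sup>2" by linarith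
  thus ?thesis unfolding freq_0 using u_pos c_pos by simp
qed

lemma freq_0_le_1: "1 / 2 \<le> c \<Longrightarrow> freq u c 0 \<le> 1"
  unfolding freq_0 using u_pos by simp

lemma freq_0_minimal:
  assumes "x\<^sup>2 < c" "c \<le> 3 / 4"  "s \<in> {0..x}"
  shows "freq u c 0 \<le> freq u c s"
proof -
  have "s\<^sup>2 \<le> x\<^sup>2" using assms by (intro power_mono) auto
  hence "s\<^sup>2 < c" using assms(1) by linarith
  thus ?thesis using assms by (intro freq_increasing c_pos u_pos) auto
qed

text \<open>
  In each of the three ranges, \<open>R\<close> is the claimed bound with its constant factors in front; its derivative is the
  quantity to which the matching bound for \<open>defect_num\<close> compares the defect.
\<close>

lemma error_c_gt_1:
  assumes x: "0 < x" "x\<^sup>2 < 1" and c1: "1 < c" and ux: "1 \<le> u * (1 - x\<^sup>2)"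
  shows "\<bar>err_r k \<alpha> x\<bar> < 2.72 * x / sqrt ((1 - x\<^sup>2) * u)"
proof -
  have xc: "x\<^sup>2 < c" using x c1 by linarith
  have sq: "s\<^sup>2 \<le> x\<^sup>2" if "s \<in> {0..x}" for s using that by (intro power_mono) auto
  define R where "R s = 2.72 / sqrt u * (s / sqrt (1 - s\<^sup>2))" for s :: real
  have "\<bar>err_r k \<alpha> x\<bar> < R x"
  proof (rule error_less[OF x xc, where M = "sqrt 6"])
    fix s assume s: "s \<in> {0..x}"
    define h where "h = 1 - s\<^sup>2"
    have h: "0 < h" using sq[OF s] x by (simp add: h_def)
    show "(R has_real_derivative 2.72 / sqrt u * (1 / (h * sqrt h))) (at s)"
      unfolding R_def[abs_def] h_def using h by (intro DERIV_cmult deriv_div_sqrt) (simp add: h_def)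
    show "(func_g k \<alpha> s)\<^sup>2 \<le> (sqrt 6)\<^sup>2 * (func_g k \<alpha> 0)\<^sup>2"
    proof (rule g_sq_le[OF x xc s, where m = "1 / 6"])
      fix t assume t: "t \<in> {0..x}"
      have "u * (1 - x\<^sup>2) \<le> u * (1 - t\<^sup>2)" using sq[OF t] u_pos by (intro mult_left_mono) auto
      thus "1 / 6 \<le> freq u c t" using sq[OF t] x ux by (intro freq_ge_sixth_c_gt_1 c1 u_pos) auto
    qed (use freq_0_le_1 c1 in auto)
    define w where "w = c - s\<^sup>2"
    have w: "0 < w" using sq[OF s] xc by (simp add: w_def)
    \<comment> \<open>The constant is \<open>10.88 = 4 * 2.72\<close>.\<close>
    have "sqrt 6 * \<bar>defect_num c (s\<^sup>2)\<bar> * sqrt h < 10.88 * (w\<^sup>2 * sqrt w)"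
      using defect_num_bound_c_gt_1[OF c1, of "s\<^sup>2"] h by (simp add: h_def w_def)
    hence "sqrt 6 * \<bar>defect_num c (s\<^sup>2)\<bar> * sqrt h / (4 * h * sqrt h * (w\<^sup>2 * sqrt w) * sqrt u)
       < 10.88 * (w\<^sup>2 * sqrt w) / (4 * h * sqrt h * (w\<^sup>2 * sqrt w) * sqrt u)"
      using h w u_pos by (intro divide_strict_right_mono) auto
    also have "\<dots> = 2.72 / sqrt u * (1 / (h * sqrt h))"
      using h w u_pos by (simp add: divide_simps)
    also have "sqrt 6 * \<bar>defect_num c (s\<^sup>2)\<bar> * sqrt h / (4 * h * sqrt h * (w\<^sup>2 * sqrt w) * sqrt u)
        = sqrt 6 * \<bar>defect_num c (s\<^sup>2)\<bar> / (4 * h * (w\<^sup>2 * sqrt w) * sqrt u)"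
      using h w u_pos by (simp add: divide_simps)
    finally show "sqrt 6 * \<bar>defect_num c (s\<^sup>2)\<bar> / (4 * h * (w\<^sup>2 * sqrt w) * sqrt u) < 2.72 / sqrt u * (1 / (h * sqrt h))" .
  qed (use x in \<open>auto simp: R_def\<close>)
  thus ?thesis by (simp add: R_def real_sqrt_mult mult_ac)
qed

lemma error_c_gt_half:
  assumes x: "0 < x" "x\<^sup>2 < c" and c1: "1 / 2 < c" "c \<le> 1"
    and dom: "1 \<le> u * (1 - x\<^sup>2) \<and> u * (1 - c) \<le> 1 / 6 \<or> 1 / 6 \<le> u * (1 - c)"
  shows "\<bar>err_r k \<alpha> x\<bar> < 2 * (1 - x\<^sup>2) * x / (c * (c - x\<^sup>2) powr (3 / 2) * sqrt u)"
proof -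
  have x1: "x\<^sup>2 < 1" using x c1 by linarith
  have sq: "s\<^sup>2 \<le> x\<^sup>2" if "s \<in> {0..x}" for s using that by (intro power_mono) auto
  define R where "R s = 2 / (c * sqrt u) * (s * (1 - s\<^sup>2) / (c - s\<^sup>2) powr (3 / 2))" for s :: real
  have "\<bar>err_r k \<alpha> x\<bar> < R x"
  proof (rule error_less[OF x(1) x1 x(2), where M = 2])
    fix s assume s: "s \<in> {0..x}"
    define w h where "w = c - s\<^sup>2" and "h = 1 - s\<^sup>2"
    have wh: "0 < w" "0 < h" using sq[OF s] x1 x by (simp_all add: h_def w_def)
    have "((\<lambda>x. x * (1 - x\<^sup>2)) has_real_derivative (1 - 3 * s\<^sup>2)) (at s)"
      by (auto intro!: derivative_eq_intros simp: power2_eq_square)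
    from deriv_powr_quotient[OF this, of c]
    have "((\<lambda>x. x * (1 - x\<^sup>2) / (c - x\<^sup>2) powr (3 / 2)) has_real_derivative
       ((1 - 3 * s\<^sup>2) * w + 3 * s * (s * (1 - s\<^sup>2))) / (w\<^sup>2 * sqrt w)) (at s)"
      using wh by (simp add: w_def)
    also have "(1 - 3 * s\<^sup>2) * w + 3 * s * (s * (1 - s\<^sup>2)) = c + (2 - 3 * c) * s\<^sup>2"
      by (simp add: w_def algebra_simps power_numeral_reduce)
    finally show "(R has_real_derivative 2 / (c * sqrt u) * ((c + (2 - 3 * c) * s\<^sup>2) / (w\<^sup>2 * sqrt w))) (at s)"
      unfolding R_def[abs_def] by (rule DERIV_cmult)
    \<comment> \<open>For \<open>c \<le> 3/4\<close> the frequency is least at 0; for larger \<open>c\<close> it stays above \<open>1/4\<close> and starts below 1.\<close>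
    show "(func_g k \<alpha> s)\<^sup>2 \<le> 2\<^sup>2 * (func_g k \<alpha> 0)\<^sup>2"
    proof (cases "c \<le> 3 / 4")
      case True
      show ?thesis
        by (rule g_sq_le[OF x(1) x1 x(2) s freq_0_pos]) (use freq_0_pos freq_0_minimal[OF x(2) True] in auto)
    next
      case False
      show ?thesis
      proof (rule g_sq_le[OF x(1) x1 x(2) s, where m = "1 / 4"])
        fix t assume t: "t \<in> {0..x}"
        have ut: "u * (1 - x\<^sup>2) \<le> u * (1 - t\<^sup>2)" using sq[OF t] u_pos by (intro mult_left_mono) auto
        have tc: "t\<^sup>2 < c" using sq[OF t] x by linarith
        show "1 / 4 \<le> freq u c t"
          using dom
        proof
          assume "1 \<le> u * (1 - x\<^sup>2) \<and> u * (1 - c) \<le> 1 / 6"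
          thus ?thesis using ut by (intro freq_ge_quarter_away_from_1 c1 u_pos tc) auto
        next
          assume "1 / 6 \<le> u * (1 - c)"
          thus ?thesis using False by (intro freq_ge_quarter_large_order u_pos tc) auto
        qed
      qed (use freq_0_le_1 c1 in auto)
    qed
    have "c * \<bar>defect_num c (s\<^sup>2)\<bar> < 4 * (c + (2 - 3 * c) * s\<^sup>2) * h"
      using defect_num_bound_c_gt_half[OF c1, of "s\<^sup>2"] wh by (simp add: h_def w_def)
    hence "c * \<bar>defect_num c (s\<^sup>2)\<bar> / (2 * c * h * (w\<^sup>2 * sqrt w) * sqrt u)
        < 4 * (c + (2 - 3 * c) * s\<^sup>2) * h / (2 * c * h * (w\<^sup>2 * sqrt w) * sqrt u)"
      using wh u_pos c_pos by (intro divide_strict_right_mono) auto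
    also have "\<dots> = 2 / (c * sqrt u) * ((c + (2 - 3 * c) * s\<^sup>2) / (w\<^sup>2 * sqrt w))"
      using wh u_pos c_pos by (simp add: divide_simps)
    also have "c * \<bar>defect_num c (s\<^sup>2)\<bar> / (2 * c * h * (w\<^sup>2 * sqrt w) * sqrt u)
        = 2 * \<bar>defect_num c (s\<^sup>2)\<bar> / (4 * h * (w\<^sup>2 * sqrt w) * sqrt u)"
      using wh u_pos c_pos by (simp add: divide_simps)
    finally show "2 * \<bar>defect_num c (s\<^sup>2)\<bar> / (4 * h * (w\<^sup>2 * sqrt w) * sqrt u) < 2 / (c * sqrt u) * ((c + (2 - 3 * c) * s\<^sup>2) / (w\<^sup>2 * sqrt w))" .
  qed (auto simp: R_def)
  thus ?thesis by (simp add: R_def mult_ac)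
qed

lemma error_c_le_half:
  assumes x: "0 < x" "x\<^sup>2 < c" and c1: "c \<le> 1 / 2"
  shows "\<bar>err_r k \<alpha> x\<bar> < (2 - c) * x / (4 * (c - x\<^sup>2) powr (3 / 2) * sqrt u)"
proof -
  have x1: "x\<^sup>2 < 1" using x c1 by linarith
  have sq: "s\<^sup>2 \<le> x\<^sup>2" if "s \<in> {0..x}" for s using that by (intro power_mono) auto
  define R where "R s = (2 - c) / (4 * sqrt u) * (s / (c - s\<^sup>2) powr (3 / 2))" for s :: real
  have "\<bar>err_r k \<alpha> x\<bar> < R x"
  proof (rule error_less[OF x(1) x1 x(2), where M = 1])
    fix s assume s: "s \<in> {0..x}"
    define w h where "w = c - s\<^sup>2" and "h = 1 - s\<^sup>2"
    have wh: "0 < w" "0 < h" using sq[OF s] x1 x by (simp_all add: h_def w_def)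
    have "((\<lambda>x. x / (c - x\<^sup>2) powr (3 / 2)) has_real_derivative (1 * w + 3 * s * s) / (w\<^sup>2 * sqrt w)) (at s)"
      using deriv_powr_quotient[OF DERIV_ident, of s c] wh by (simp add: w_def)
    also have "1 * w + 3 * s * s = c + 2 * s\<^sup>2"
      by (simp add: w_def power2_eq_square)
    finally show "(R has_real_derivative (2 - c) / (4 * sqrt u) * ((c + 2 * s\<^sup>2) / (w\<^sup>2 * sqrt w))) (at s)"
      unfolding R_def[abs_def] by (rule DERIV_cmult)
    show "(func_g k \<alpha> s)\<^sup>2 \<le> 1\<^sup>2 * (func_g k \<alpha> 0)\<^sup>2"
      by (rule g_sq_le[OF x(1) x1 x(2) s freq_0_pos]) (use c1 freq_0_minimal[OF x(2)] in auto)
    have "\<bar>defect_num c (s\<^sup>2)\<bar> < (2 - c) * (c + 2 * s\<^sup>2) * h"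
      using defect_num_bound_c_le_half[OF c_pos c1, of "s\<^sup>2"] wh by (simp add: h_def w_def)
    hence "\<bar>defect_num c (s\<^sup>2)\<bar> / (4 * h * (w\<^sup>2 * sqrt w) * sqrt u)
        < (2 - c) * (c + 2 * s\<^sup>2) * h / (4 * h * (w\<^sup>2 * sqrt w) * sqrt u)"
      using wh u_pos by (intro divide_strict_right_mono) auto
    thus "1 * \<bar>defect_num c (s\<^sup>2)\<bar> / (4 * h * (w\<^sup>2 * sqrt w) * sqrt u) < (2 - c) / (4 * sqrt u) * ((c + 2 * s\<^sup>2) / (w\<^sup>2 * sqrt w))"
      using wh u_pos by (simp add: mult_ac)
  qed (auto simp: R_def)
  thus ?thesis by (simp add: R_def mult_ac)
qed

lemma error_strict:
  assumes x: "0 < x"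
    and dom: "x\<^sup>2 < 1 \<and> 1 \<le> u * (1 - x\<^sup>2) \<and> u * (1 - c) < 1 / 6 \<or> x \<le> sqrt c \<and> 1 / 6 \<le> u * (1 - c)"
  shows "ereal \<bar>err_r k \<alpha> x\<bar> < err_bound k \<alpha> x"
proof -
  have q: "param_q k \<alpha> = 1 - c" by (simp add: c)
  have c1: "c \<le> 1" if "1 / 6 \<le> u * (1 - c)"
  proof (rule ccontr)
    assume "\<not> c \<le> 1"
    hence "u * (1 - c) < 0" using u_pos by (intro mult_pos_neg) auto
    thus False using that by linarith
  qed
  have xc: "x\<^sup>2 < c" if ne: "c \<le> 1 \<longrightarrow> x \<noteq> sqrt c"
    using dom
  proof
    assume "x\<^sup>2 < 1 \<and> 1 \<le> u * (1 - x\<^sup>2) \<and> u * (1 - c) < 1 / 6"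
    hence "u * (1 - c) < u * (1 - x\<^sup>2)" by linarith
    thus ?thesis using u_pos by simp
  next
    assume *: "x \<le> sqrt c \<and> 1 / 6 \<le> u * (1 - c)"
    hence "x < sqrt c" using ne c1 by force
    hence "x\<^sup>2 < (sqrt c)\<^sup>2" using x by (intro power_strict_mono) auto
    thus ?thesis using c_pos by simp
  qed
  consider "1 < c" | "c \<le> 1" "x = sqrt c" | "c \<le> 1" "x \<noteq> sqrt c" "1 / 2 < c" | "x \<noteq> sqrt c" "c \<le> 1 / 2"
    by linarith
  thus ?thesis
  proof cases
    case 1
    hence "\<bar>err_r k \<alpha> x\<bar> < 2.72 * x / sqrt ((1 - x\<^sup>2) * u)" using x dom c1 by (intro error_c_gt_1) auto
    thus ?thesis using 1 by (simp add: err_bound_def q u[symmetric] Let_def)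
  next
    case 2
    thus ?thesis by (simp add: err_bound_def q Let_def)
  next
    case 3
    hence "\<bar>err_r k \<alpha> x\<bar> < 2 * (1 - x\<^sup>2) * x / (c * (c - x\<^sup>2) powr (3 / 2) * sqrt u)"
      using x xc dom by (intro error_c_gt_half) auto
    thus ?thesis using 3 by (simp add: err_bound_def q u[symmetric] Let_def)
  next
    case 4
    hence "\<bar>err_r k \<alpha> x\<bar> < (2 - c) * x / (4 * (c - x\<^sup>2) powr (3 / 2) * sqrt u)"
      using x xc dom by (intro error_c_le_half) auto
    thus ?thesis using 4 by (simp add: err_bound_def q u[symmetric] Let_def)
  qed
qed

lemma error_at_0: "err_r k \<alpha> 0 = 0" "0 \<le> err_bound k \<alpha> 0"
proof -
  have "phase_B k \<alpha> 0 = 0" using phase_eq[of 0] c_pos \<theta>_0 by simp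
  thus "err_r k \<alpha> 0 = 0" using g_0_nonzero by (simp add: err_r_def)
  show "0 \<le> err_bound k \<alpha> 0" by (simp add: err_bound_def Let_def)
qed

end

theorem theorem1:
  fixes k :: nat and \<alpha> x :: real
  assumes "k \<ge> 2" and "even k"
    and "\<alpha> \<ge> - (2 * real k + 1) / 4"
    and "(\<bar>\<alpha>\<bar> < sqrt (7 / 6) \<and> 0 \<le> x \<and> x \<le> sqrt (1 - 1 / param_u k \<alpha>))
       \<or> (\<alpha> \<in> {- (2 * real k + 1) / 4 .. - sqrt (7 / 6)} \<union> {sqrt (7 / 6) ..}
          \<and> 0 \<le> x \<and> x \<le> sqrt (1 - param_q k \<alpha>))"
  shows "func_g k \<alpha> x = func_g k \<alpha> 0 * (cos (phase_B k \<alpha> x) + err_r k \<alpha> x)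
       \<and> func_g k \<alpha> 0 = (- 1 / 4) ^ (k div 2) * ((real k + \<alpha>) gchoose (k div 2))
            * ((real k)\<^sup>2 + 2 * real k * \<alpha> + real k + \<alpha> + 1) powr (1 / 4)
       \<and> ereal \<bar>err_r k \<alpha> x\<bar> \<le> err_bound k \<alpha> x
       \<and> (x > 0 \<longrightarrow> ereal \<bar>err_r k \<alpha> x\<bar> < err_bound k \<alpha> x)"
proof -
  define u c where "u = param_u k \<alpha>" and "c = 1 - param_q k \<alpha>"
  interpret ultraspherical k \<alpha> u c
    by unfold_locales (use assms in \<open>auto simp: u_def c_def\<close>)
  have split: "\<bar>\<alpha>\<bar> < sqrt (7 / 6) \<longleftrightarrow> u * (1 - c) < 1 / 6"
    unfolding u_q by (subst real_sqrt_abs[symmetric], subst real_sqrt_less_iff) auto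
  have dom: "x\<^sup>2 < 1 \<and> 1 \<le> u * (1 - x\<^sup>2) \<and> u * (1 - c) < 1 / 6 \<or> x \<le> sqrt c \<and> 1 / 6 \<le> u * (1 - c)"
    using assms(4)
  proof
    assume *: "\<bar>\<alpha>\<bar> < sqrt (7 / 6) \<and> 0 \<le> x \<and> x \<le> sqrt (1 - 1 / param_u k \<alpha>)"
    have "x\<^sup>2 \<le> (sqrt (1 - 1 / u))\<^sup>2" using * by (intro power_mono) (auto simp: u_def)
    also have "\<dots> = 1 - 1 / u" using u_ge by simp
    finally have "1 / u \<le> 1 - x\<^sup>2" by simp
    moreover from this have "1 \<le> u * (1 - x\<^sup>2)" using u_pos by (simp add: field_simps)
    moreover have "0 < 1 / u" using u_pos by simp
    ultimately show ?thesis using * split by linarith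
  next
    assume *: "\<alpha> \<in> {- (2 * real k + 1) / 4 .. - sqrt (7 / 6)} \<union> {sqrt (7 / 6) ..}
          \<and> 0 \<le> x \<and> x \<le> sqrt (1 - param_q k \<alpha>)"
    hence "\<not> \<bar>\<alpha>\<bar> < sqrt (7 / 6)" by auto
    thus ?thesis using * split by (auto simp: c_def)
  qed
  have strict: "ereal \<bar>err_r k \<alpha> x\<bar> < err_bound k \<alpha> x" if "0 < x"
    using error_strict[OF that dom] .
  have "func_g k \<alpha> x = func_g k \<alpha> 0 * (cos (phase_B k \<alpha> x) + err_r k \<alpha> x)"
    using g_0_nonzero by (simp add: err_r_def)
  moreover have "ereal \<bar>err_r k \<alpha> x\<bar> \<le> err_bound k \<alpha> x"
  proof (cases "x = 0")
    case True
    thus ?thesis using error_at_0 by (simp add: zero_ereal_def)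
  next
    case False
    thus ?thesis using assms(4) strict by (auto simp: less_imp_le)
  qed
  ultimately show ?thesis using g_0 strict by simp
qed

end
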